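(* Let $u:[0,1]\to[0,1]$ be measurable and let $v(x,y)=(1,u(x))$ for $(x,y)\in[0,1]\times[0,1]$. Fix $0<\delta\le 1$ and $0<w\ll 1$. Then for every $1<p<\infty$ there is a constant $C_p$, independent of $w$, $\delta$ and $u$, such that for all $f\in L^p(\mathbb R^2)$, $$\|M_{\mathcal R_{\delta,w,v}}f\|_{L^p(\mathbb R^2)}\le \frac{C_p}{\delta}\,\|f\|_{L^p(\mathbb R^2)}.$$
   Context: For a (closed) rectangle $R$ in the plane whose long side is not vertical, $L(R)$ denotes its length (long side), $W(R)$ its width (short side), with $L(R)\ge W(R)$, and $\mathrm{slope}(R)$ the slope of its long side. The interval of uncertainty $EX(R)$ is the interval of length $W(R)/L(R)$ centered at $\mathrm{slope}(R)$. Set $V(R)=\{(x,y)\in R : x\in[0,1],\ u(x)\in EX(R)\}$. Define $$\mathcal R_{\delta,w,v}=\{R : W(R)=w,\ L(R)\le 1,\ |V(R)|\ge \delta|R|\},$$ where $|\cdot|$ denotes Lebesgue measure. For a collection $\mathcal R$ of sets, the maximal operator is $M_{\mathcal R}f(z)=\sup_{z\in R\in\mathcal R}\frac{1}{|R|}\int_R|f|$ (and $0$ if no $R\in\mathcal R$ contains $z$). *)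

theory Defs
  imports "HOL-Analysis.Analysis"
begin

definition rect :: "real \<times> real \<Rightarrow> real \<Rightarrow> real \<Rightarrow> real \<Rightarrow> (real \<times> real) set" where
  "rect c th Lr Wr =
     {(fst c + s * cos th - t * sin th, snd c + s * sin th + t * cos th) | s t.
        \<bar>s\<bar> \<le> Lr / 2 \<and> \<bar>t\<bar> \<le> Wr / 2}"

definition EX_int :: "real \<Rightarrow> real \<Rightarrow> real \<Rightarrow> real set" where
  "EX_int th Lr Wr = {tan th - Wr / (2 * Lr) .. tan th + Wr / (2 * Lr)}"

definition Vset :: "(real \<Rightarrow> real) \<Rightarrow> real \<times> real \<Rightarrow> real \<Rightarrow> real \<Rightarrow> real \<Rightarrow> (real \<times> real) set" where
  "Vset u c th Lr Wr = {z \<in> rect c th Lr Wr. fst z \<in> {0..1} \<and> u (fst z) \<in> EX_int th Lr Wr}"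

definition Rfam :: "(real \<Rightarrow> real) \<Rightarrow> real \<Rightarrow> real \<Rightarrow> (real \<times> real) set set" where
  "Rfam u \<delta> w = {rect c th Lr w | c th Lr.
      cos th \<noteq> 0 \<and> w \<le> Lr \<and> Lr \<le> 1 \<and>
      measure lebesgue (Vset u c th Lr w) \<ge> \<delta> * measure lebesgue (rect c th Lr w)}"

definition maxop :: "(real \<times> real) set set \<Rightarrow> (real \<times> real \<Rightarrow> real) \<Rightarrow> real \<times> real \<Rightarrow> ennreal" where
  "maxop \<R> f z = (SUP R \<in> {R \<in> \<R>. z \<in> R}.
      ennreal (1 / measure lebesgue R) * (\<integral>\<^sup>+ x \<in> R. ennreal \<bar>f x\<bar> \<partial>lebesgue))"

text \<open>Real power of an extended nonnegative real (for positive exponent).\<close>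
definition epowr :: "ennreal \<Rightarrow> real \<Rightarrow> ennreal" where
  "epowr a q = (if a = \<infinity> then \<infinity> else ennreal (enn2real a powr q))"

definition Lp_norm :: "real \<Rightarrow> (real \<times> real \<Rightarrow> ennreal) \<Rightarrow> ennreal" where
  "Lp_norm p g = epowr (\<integral>\<^sup>+ z. epowr (g z) p \<partial>lebesgue) (1 / p)"

end

theory Submission
  imports Defs
begin

text \<open>
  A rectangle of the family is comparable to a strip over an interval \<open>J\<close> around a line of slope
  \<open>s\<close>; write \<open>W\<close> for its interval of uncertainty and \<open>E\<close> for the set of \<open>x \<in> J\<close> with \<open>u x \<in> W\<close>,
  so that \<open>E\<close> has density at least a multiple of \<open>\<delta>\<close> in \<open>J\<close>. A Vitali selection by decreasing length
  discards a strip if it meets a longer selected one with overlapping \<open>W\<close>, because it then lies in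
  a dilate of the latter. Hence selected strips through a common point have disjoint \<open>W\<close>. Fix one
  selected strip and consider the shorter ones that meet it. A second selection, now on the boxes
  \<open>J \<times> W\<close>, yields boxes that are pairwise disjoint, so their sets \<open>E\<close> are disjoint, and at each
  point at most two of the strips are assigned to each selected box. The overlap is thus dominated
  by a sum of indicators of dilated intervals \<open>J\<close> with a Carleson packing condition, whose moments of
  order \<open>m\<close> are bounded by \<open>\<delta> ^ (- m)\<close>. Dually, this is a weak type estimate with constant
  proportional to \<open>1 / \<delta>\<close> at the exponent \<open>1 + 1 / m\<close>, and Marcinkiewicz interpolation with the
  trivial bound for bounded functions gives every \<open>p > 1\<close>.
\<close>

subsection \<open>Selection and packing\<close>

text \<open>Elements enter in order of decreasing \<open>l\<close>, hence the ranking by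
  \<open>- l x\<close>. A new element either conflicts with a selected one, which is at least as
  large and so covers it, or it is selected itself.\<close>

lemma greedy_selection:
  fixes l :: "'a \<Rightarrow> real"
  assumes "finite A" and refl: "\<And>x. x \<in> A \<Longrightarrow> conf x x" and sym: "\<And>x y. conf x y \<Longrightarrow> conf y x"
  obtains G where "G \<subseteq> A"
    and "\<And>x y. x \<in> G \<Longrightarrow> y \<in> G \<Longrightarrow> x \<noteq> y \<Longrightarrow> \<not> conf x y"
    and "\<And>x. x \<in> A \<Longrightarrow> \<exists>y\<in>G. conf x y \<and> l x \<le> l y"
  using assms(1,2)
proof (induction arbitrary: thesis rule: finite_ranking_induct[where f = "\<lambda>x. - l x"])
  case empty
  then show ?case by blast
next
  case (insert x S)
  obtain G where G: "G \<subseteq> S" "\<And>x y. x \<in> G \<Longrightarrow> y \<in> G \<Longrightarrow> x \<noteq> y \<Longrightarrow> \<not> conf x y"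
    "\<And>x. x \<in> S \<Longrightarrow> \<exists>y\<in>G. conf x y \<and> l x \<le> l y"
    using insert.IH[OF _ insert.prems(2)] by (metis insertI2)
  have le: "l x \<le> l y" if "y \<in> S" for y using insert.hyps(2)[OF that] by simp
  show ?case
  proof (cases "\<exists>y\<in>G. conf x y")
    case True
    then obtain y where y: "y \<in> G" "conf x y" by blast
    show ?thesis
    proof (rule insert.prems(1))
      show "G \<subseteq> insert x S" using G(1) by blast
      show "\<exists>q\<in>G. conf p q \<and> l p \<le> l q" if "p \<in> insert x S" for p
        using that y le G by (cases "p = x") auto
    qed (rule G(2))
  next
    case False
    show ?thesis
    proof (rule insert.prems(1))
      show "insert x G \<subseteq> insert x S" using G(1) by blast
      show "\<not> conf p q" if "p \<in> insert x G" "q \<in> insert x G" "p \<noteq> q" for p q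
        using that False G(2) sym[of p q] by auto
      show "\<exists>q\<in>insert x G. conf p q \<and> l p \<le> l q" if "p \<in> insert x S" for p
        using that insert.prems(2) G(3) by (cases "p = x") auto
    qed
  qed
qed

text \<open>Insertion in order of increasing \<open>l\<close> gives the last of \<open>n + 1\<close>
  elements the rank \<open>n + 1\<close>, and a difference of consecutive powers is at most
  \<open>Suc m * Suc n ^ m\<close>. The inequality trades one power of a counting function for a sum
  over the counted members, so that moments can be bounded by induction.\<close>

lemma card_power_le_sum_ranks:
  fixes l :: "'a \<Rightarrow> real"
  assumes "finite A"
  shows "card A ^ Suc m \<le> Suc m * (\<Sum>i\<in>A. card {j \<in> A. l j \<le> l i} ^ m)"
  using assms
proof (induction rule: finite_ranking_induct[where f = l])
  case empty
  then show ?case by simp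
next
  case (insert x S)
  show ?case
  proof (cases "x \<in> S")
    case True
    then show ?thesis using insert by (simp add: insert_absorb)
  next
    case False
    define n where "n = card S"
    have pow: "Suc n ^ Suc k \<le> n ^ Suc k + Suc k * Suc n ^ k" for k
    proof (induction k)
      case (Suc k)
      have "Suc n ^ Suc (Suc k) = n * Suc n ^ Suc k + Suc n ^ Suc k" by simp
      also have "\<dots> \<le> n * (n ^ Suc k + Suc k * Suc n ^ k) + Suc n ^ Suc k"
        using Suc by (intro add_mono mult_mono) auto
      also have "\<dots> \<le> n ^ Suc (Suc k) + Suc (Suc k) * Suc n ^ Suc k"
        by (simp add: algebra_simps)
      finally show ?case .
    qed simp
    have top: "{j \<in> insert x S. l j \<le> l x} = insert x S" using insert by auto
    have "card (insert x S) ^ Suc m \<le> n ^ Suc m + Suc m * Suc n ^ m"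
      using pow[of m] False insert.hyps by (simp add: n_def)
    also have "\<dots> \<le> Suc m * (\<Sum>i\<in>S. card {j \<in> S. l j \<le> l i} ^ m) + Suc m * Suc n ^ m"
      using insert.IH by (simp add: n_def)
    \<comment> \<open>Older elements that tie with \<open>x\<close> gain one in rank, which only
      enlarges the right-hand side.\<close>
    also have "\<dots> \<le> Suc m * (\<Sum>i\<in>S. card {j \<in> insert x S. l j \<le> l i} ^ m) + Suc m * Suc n ^ m"
      using insert.hyps(1)
      by (intro add_mono mult_mono sum_mono power_mono card_mono) auto
    also have "\<dots> = Suc m * (\<Sum>i\<in>insert x S. card {j \<in> insert x S. l j \<le> l i} ^ m)"
      using False insert.hyps(1) top by (simp add: n_def algebra_simps del: insert_iff)
    finally show ?thesis .
  qed
qed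

text \<open>The start \<open>6\<close> is the length of \<open>{a - 3 * r..a + 3 * r}\<close> in
  units of \<open>r\<close>. Each further power contributes \<open>Suc m\<close> from the rank
  expansion, \<open>7\<close> from an enlarged radius and \<open>2\<close> from the packing
  bound.\<close>

fun packing_const :: "nat \<Rightarrow> real" where
  "packing_const 0 = 6"
| "packing_const (Suc m) = 14 * Suc m * packing_const m"

lemma packing_const_pos: "packing_const m > 0"
  by (induction m) auto

text \<open>Disjointness and density of the sets \<open>E i\<close> give the Carleson packing bound
  \<open>2 * r / d\<close> for the sum of the \<open>L i\<close>. In the rank expansion the term of
  \<open>j\<close> counts intervals no longer than \<open>L j\<close> and close to
  \<open>c j\<close>. They satisfy the same hypotheses with centre \<open>c j\<close> and radius
  \<open>7 * L j\<close>, so the induction on \<open>m\<close> keeps \<open>a\<close> and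
  \<open>r\<close> general, and each power costs one packing bound.\<close>

lemma packing_power_integral:
  fixes c L :: "'i \<Rightarrow> real" and E :: "'i \<Rightarrow> real set"
  assumes "finite T" "d > 0"
    and "\<And>i. i \<in> T \<Longrightarrow> L i > 0"
    and "\<And>i. i \<in> T \<Longrightarrow> E i \<in> sets lebesgue"
    and "\<And>i. i \<in> T \<Longrightarrow> E i \<subseteq> {c i - L i..c i + L i}"
    and "\<And>i. i \<in> T \<Longrightarrow> emeasure lebesgue (E i) \<ge> ennreal (d * L i)"
    and "disjoint_family_on E T"
    and "r \<ge> 0"
    and "\<And>i. i \<in> T \<Longrightarrow> {c i - L i..c i + L i} \<subseteq> {a - r..a + r}"
  shows "(\<integral>\<^sup>+x. of_nat (card {i \<in> T. \<bar>x - c i\<bar> \<le> 3 * L i} ^ m) * indicator {a - 3 * r..a + 3 * r} x \<partial>lborel)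
          \<le> ennreal (packing_const m / d ^ m * r)"
  using assms(1,3-)
proof (induction m arbitrary: T a r)
  case 0
  then show ?case by simp
next
  case (Suc m)
  note fin = Suc.prems(1) and L = Suc.prems(2) and Em = Suc.prems(3) and EJ = Suc.prems(4)
    and dens = Suc.prems(5) and disj = Suc.prems(6) and r = Suc.prems(7) and sub = Suc.prems(8)
  define S where "S = (\<lambda>j x. {i \<in> T. \<bar>x - c i\<bar> \<le> 3 * L i \<and> L i \<le> L j})"
  have meas: "(\<lambda>x. of_nat (card {i \<in> T. \<bar>x - c i\<bar> \<le> 3 * L i \<and> Q i} ^ k) :: ennreal) \<in> borel_measurable borel" for Q k
  proof -
    have "of_nat (card {i \<in> T. \<bar>x - c i\<bar> \<le> 3 * L i \<and> Q i}) =
       (\<Sum>i\<in>{i\<in>T. Q i}. indicator {x. \<bar>x - c i\<bar> \<le> 3 * L i} x :: ennreal)" for x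
    proof -
      have "(\<Sum>i\<in>{i\<in>T. Q i}. indicator {x. \<bar>x - c i\<bar> \<le> 3 * L i} x :: ennreal) = (\<Sum>i\<in>{i \<in> T. \<bar>x - c i\<bar> \<le> 3 * L i \<and> Q i}. 1)"
        using fin by (intro sum.mono_neutral_cong_right) (auto simp: indicator_def)
      then show ?thesis by simp
    qed
    then show ?thesis unfolding of_nat_power by simp
  qed
  \<comment> \<open>The indicator of radius \<open>3 * (7 * L j)\<close> is implied by that of
    radius \<open>3 * L j\<close>; it gives the integrand the shape of the induction
    hypothesis.\<close>
  have pt: "(of_nat (card {i \<in> T. \<bar>x - c i\<bar> \<le> 3 * L i} ^ Suc m) :: ennreal) * indicator {a - 3 * r..a + 3 * r} x
      \<le> (\<Sum>j\<in>T. of_nat (Suc m) * (of_nat (card (S j x) ^ m) * indicator {c j - 3 * (7 * L j)..c j + 3 * (7 * L j)} x * indicator {c j - 3 * L j..c j + 3 * L j} x))" for x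
  proof -
    let ?A = "{i \<in> T. \<bar>x - c i\<bar> \<le> 3 * L i}"
    have S: "{j \<in> ?A. L j \<le> L i} = S i x" for i by (auto simp: S_def)
    have "card ?A ^ Suc m \<le> Suc m * (\<Sum>i\<in>?A. card (S i x) ^ m)"
      using card_power_le_sum_ranks[of ?A m L] fin unfolding S by simp
    then have "of_nat (card ?A ^ Suc m) \<le> (of_nat (Suc m * (\<Sum>i\<in>?A. card (S i x) ^ m)) :: ennreal)"
      by (rule of_nat_mono)
    also have "\<dots> = (\<Sum>i\<in>?A. of_nat (Suc m) * of_nat (card (S i x) ^ m))"
      by (simp only: of_nat_mult of_nat_sum sum_distrib_left)
    also have "\<dots> = (\<Sum>i\<in>?A. of_nat (Suc m) * (of_nat (card (S i x) ^ m) * indicator {c i - 3 * (7 * L i)..c i + 3 * (7 * L i)} x * indicator {c i - 3 * L i..c i + 3 * L i} x))"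
      using L by (intro sum.cong) (fastforce simp: indicator_def)+
    also have "\<dots> \<le> (\<Sum>j\<in>T. of_nat (Suc m) * (of_nat (card (S j x) ^ m) * indicator {c j - 3 * (7 * L j)..c j + 3 * (7 * L j)} x * indicator {c j - 3 * L j..c j + 3 * L j} x))"
      using fin by (intro sum_mono2) auto
    finally show ?thesis
      by (cases "x \<in> {a - 3 * r..a + 3 * r}") (simp_all del: of_nat_Suc power_Suc of_nat_power)
  qed
  have each: "(\<integral>\<^sup>+x. of_nat (card (S j x) ^ m) * indicator {c j - 3 * (7 * L j)..c j + 3 * (7 * L j)} x * indicator {c j - 3 * L j..c j + 3 * L j} x \<partial>lborel)
      \<le> ennreal (packing_const m / d ^ m * (7 * L j))" if j: "j \<in> T" for j
  proof -
    \<comment> \<open>Here \<open>7 = 3 + 3 + 1\<close>: from \<open>c j\<close> to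
      \<open>x\<close>, from \<open>x\<close> to \<open>c i\<close>, and from \<open>c i\<close> to
      an endpoint, where \<open>L i \<le> L j\<close>.\<close>
    define T' where "T' = {i \<in> T. L i \<le> L j \<and> {c i - L i..c i + L i} \<subseteq> {c j - 7 * L j..c j + 7 * L j}}"
    have T': "T' \<subseteq> T" by (auto simp: T'_def)
    have IH': "(\<integral>\<^sup>+x. of_nat (card {i \<in> T'. \<bar>x - c i\<bar> \<le> 3 * L i} ^ m) * indicator {c j - 3 * (7 * L j)..c j + 3 * (7 * L j)} x \<partial>lborel)
          \<le> ennreal (packing_const m / d ^ m * (7 * L j))"
    proof (rule Suc.IH)
      show "finite T'" "disjoint_family_on E T'"
        using finite_subset[OF T' fin] disjoint_family_on_mono[OF T' disj] by auto
      show "0 \<le> 7 * L j" using L[OF j] by simp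
      fix i assume "i \<in> T'"
      then have i: "i \<in> T" "{c i - L i..c i + L i} \<subseteq> {c j - 7 * L j..c j + 7 * L j}"
        by (auto simp: T'_def)
      show "0 < L i" "E i \<in> sets lebesgue" "E i \<subseteq> {c i - L i..c i + L i}"
        "ennreal (d * L i) \<le> emeasure lebesgue (E i)"
        "{c i - L i..c i + L i} \<subseteq> {c j - 7 * L j..c j + 7 * L j}"
        by (fact L[OF i(1)] Em[OF i(1)] EJ[OF i(1)] dens[OF i(1)] i(2))+
    qed
    have sub': "S j x \<subseteq> {i \<in> T'. \<bar>x - c i\<bar> \<le> 3 * L i}" if "x \<in> {c j - 3 * L j..c j + 3 * L j}" for x
      using that L by (auto simp: S_def T'_def abs_le_iff)
    have "of_nat (card (S j x) ^ m) * indicator {c j - 3 * (7 * L j)..c j + 3 * (7 * L j)} x * indicator {c j - 3 * L j..c j + 3 * L j} x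
        \<le> (of_nat (card {i \<in> T'. \<bar>x - c i\<bar> \<le> 3 * L i} ^ m) * indicator {c j - 3 * (7 * L j)..c j + 3 * (7 * L j)} x :: ennreal)" for x
    proof (cases "x \<in> {c j - 3 * L j..c j + 3 * L j}")
      case True
      have "card (S j x) \<le> card {i \<in> T'. \<bar>x - c i\<bar> \<le> 3 * L i}"
        using sub'[OF True] finite_subset[OF T' fin] by (intro card_mono) simp_all
      then have "(of_nat (card (S j x) ^ m) :: ennreal) \<le> of_nat (card {i \<in> T'. \<bar>x - c i\<bar> \<le> 3 * L i} ^ m)"
        by (intro of_nat_mono power_mono) simp_all
      then show ?thesis by (simp only: indicator_simps(1)[OF True] mult_1_right mult_right_mono zero_le)
    next
      case False
      then show ?thesis by simp
    qed
    then show ?thesis by (rule order_trans[OF nn_integral_mono IH'])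
  qed
  have total: "(\<Sum>j\<in>T. L j) \<le> 2 * r / d"
  proof -
    have "ennreal (\<Sum>j\<in>T. d * L j) = (\<Sum>j\<in>T. ennreal (d * L j))"
      using L assms(2) by (intro sum_ennreal[symmetric]) (simp add: less_imp_le)
    also have "\<dots> \<le> (\<Sum>j\<in>T. emeasure lebesgue (E j))" by (intro sum_mono dens)
    also have "\<dots> = emeasure lebesgue (\<Union>j\<in>T. E j)"
      using disj fin Em by (intro sum_emeasure) auto
    also have "\<dots> \<le> emeasure lebesgue {a - r..a + r}"
      using EJ sub by (intro emeasure_mono) (blast, simp)
    also have "\<dots> = emeasure lborel {a - r..a + r}" by simp
    also have "\<dots> = ennreal (2 * r)" using r by (subst emeasure_lborel_Icc) simp_all
    finally have "ennreal (\<Sum>j\<in>T. d * L j) \<le> ennreal (2 * r)" .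
    then have "d * (\<Sum>j\<in>T. L j) \<le> 2 * r" using r by (simp only: ennreal_le_iff sum_distrib_left)
    then show ?thesis using assms(2) by (simp add: pos_le_divide_eq mult.commute)
  qed
  have "(\<integral>\<^sup>+x. of_nat (card {i \<in> T. \<bar>x - c i\<bar> \<le> 3 * L i} ^ Suc m) * indicator {a - 3 * r..a + 3 * r} x \<partial>lborel)
     \<le> (\<integral>\<^sup>+x. (\<Sum>j\<in>T. of_nat (Suc m) * (of_nat (card (S j x) ^ m) * indicator {c j - 3 * (7 * L j)..c j + 3 * (7 * L j)} x * indicator {c j - 3 * L j..c j + 3 * L j} x)) \<partial>lborel)"
    by (intro nn_integral_mono pt)
  also have "\<dots> = (\<Sum>j\<in>T. of_nat (Suc m) * (\<integral>\<^sup>+x. of_nat (card (S j x) ^ m) * indicator {c j - 3 * (7 * L j)..c j + 3 * (7 * L j)} x * indicator {c j - 3 * L j..c j + 3 * L j} x \<partial>lborel))"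
    unfolding S_def using meas by (subst nn_integral_sum) (auto intro!: sum.cong nn_integral_cmult)
  also have "\<dots> \<le> (\<Sum>j\<in>T. of_nat (Suc m) * ennreal (packing_const m / d ^ m * (7 * L j)))"
    by (intro sum_mono mult_left_mono each) auto
  also have "\<dots> = (\<Sum>j\<in>T. ennreal (real (Suc m) * (packing_const m / d ^ m * (7 * L j))))"
    using packing_const_pos[of m] L assms(2) by (intro sum.cong refl) (simp only: ennreal_mult' ennreal_of_nat_eq_real_of_nat of_nat_0_le_iff)
  also have "\<dots> = ennreal (\<Sum>j\<in>T. Suc m * (packing_const m / d ^ m * (7 * L j)))"
    using packing_const_pos[of m] L assms(2) by (intro sum_ennreal) (auto simp: less_imp_le)
  also have "(\<Sum>j\<in>T. Suc m * (packing_const m / d ^ m * (7 * L j))) = 7 * Suc m * packing_const m / d ^ m * (\<Sum>j\<in>T. L j)"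
    by (subst sum_distrib_left) (simp add: mult_ac)
  also have "\<dots> \<le> 7 * Suc m * packing_const m / d ^ m * (2 * r / d)"
    using packing_const_pos[of m] assms(2) by (intro mult_left_mono total) auto
  also have "\<dots> = packing_const (Suc m) / d ^ Suc m * r" by (simp add: field_simps)
  finally show ?case by (simp add: ennreal_leI)
qed

subsection \<open>Overlap of strips\<close>

text \<open>A parallelogram around the line of slope \<open>s\<close> through \<open>(c, a)\<close>,
  with \<open>b\<close> measured vertically. All its vertical sections have length
  \<open>2 * b\<close>, which suits integration in the vertical direction first.\<close>

definition strip :: "real \<Rightarrow> real \<Rightarrow> real \<Rightarrow> real \<Rightarrow> real \<Rightarrow> (real \<times> real) set" where
  "strip c a s l b = {z. \<bar>fst z - c\<bar> \<le> l \<and> \<bar>snd z - a - s * (fst z - c)\<bar> \<le> b}"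

lemma closed_strip: "closed (strip c a s l b)"
  unfolding strip_def by (intro closed_Collect_conj closed_Collect_le continuous_intros)

lemma sets_strip [measurable]: "strip c a s l b \<in> sets borel"
  by (intro borel_closed closed_strip)

text \<open>Tonelli, with vertical sections of constant length. This transfers counts that depend on
  the first coordinate alone to the one-dimensional packing lemma.\<close>

lemma nn_integral_strip:
  fixes g :: "real \<Rightarrow> ennreal"
  assumes [measurable]: "g \<in> borel_measurable borel" and b: "b \<ge> 0"
  shows "(\<integral>\<^sup>+z. g (fst z) * indicator (strip c a s l b) z \<partial>lborel) =
     ennreal (2 * b) * (\<integral>\<^sup>+x. g x * indicator {c - l..c + l} x \<partial>lborel)"
proof -
  have *: "g x * indicator (strip c a s l b) (x, y) =
      g x * indicator {c - l..c + l} x * indicator {a + s * (x - c) - b..a + s * (x - c) + b} y" for x y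
    by (auto simp: strip_def indicator_def abs_le_iff)
  have "(\<integral>\<^sup>+z. g (fst z) * indicator (strip c a s l b) z \<partial>lborel) =
      (\<integral>\<^sup>+z. g (fst z) * indicator (strip c a s l b) z \<partial>(lborel \<Otimes>\<^sub>M lborel))"
    by (simp only: lborel_prod)
  also have "\<dots> = (\<integral>\<^sup>+x. \<integral>\<^sup>+y. g x * indicator (strip c a s l b) (x, y) \<partial>lborel \<partial>lborel)"
  proof (subst lborel.nn_integral_fst[symmetric])
    have "(\<lambda>z. g (fst z) * indicator (strip c a s l b) z) \<in> borel_measurable borel"
      by (intro borel_measurable_times_ennreal borel_measurable_indicator sets_strip
          measurable_compose[OF borel_measurable_continuous_onI assms(1)] continuous_intros)
    then show "(\<lambda>z. g (fst z) * indicator (strip c a s l b) z) \<in> borel_measurable (lborel \<Otimes>\<^sub>M lborel)"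
      by (simp only: lborel_prod measurable_lborel1 measurable_lborel2)
  qed simp
  also have "\<dots> = (\<integral>\<^sup>+x. \<integral>\<^sup>+y. g x * indicator {c - l..c + l} x * indicator {a + s * (x - c) - b..a + s * (x - c) + b} y \<partial>lborel \<partial>lborel)"
    by (simp only: *)
  also have "\<dots> = (\<integral>\<^sup>+x. g x * indicator {c - l..c + l} x * ennreal (2 * b) \<partial>lborel)"
    using b by (intro nn_integral_cong) (subst nn_integral_cmult_indicator, simp_all)
  also have "\<dots> = ennreal (2 * b) * (\<integral>\<^sup>+x. g x * indicator {c - l..c + l} x \<partial>lborel)"
    by (simp add: nn_integral_cmult[symmetric] mult_ac)
  finally show ?thesis .
qed

lemma emeasure_strip:
  assumes "l \<ge> 0" "b \<ge> 0"
  shows "emeasure lborel (strip c a s l b) = ennreal (4 * l * b)"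
proof -
  have "emeasure lborel (strip c a s l b) = (\<integral>\<^sup>+z. 1 * indicator (strip c a s l b) z \<partial>lborel)"
    by simp
  also have "\<dots> = ennreal (2 * b) * ennreal (2 * l)"
    using assms by (subst nn_integral_strip) simp_all
  also have "\<dots> = ennreal (4 * l * b)" 
    using assms by (simp add: ennreal_mult[symmetric] mult_ac)
  finally show ?thesis .
qed

lemma card_disjoint_family_point:
  assumes "disjoint_family_on I A"
  shows "card {i \<in> A. x \<in> I i} \<le> 1"
proof (cases "{i \<in> A. x \<in> I i} = {}")
  case True
  then show ?thesis by (simp only: card.empty)
next
  case False
  then obtain i where i: "i \<in> A" "x \<in> I i" by blast
  have "{i \<in> A. x \<in> I i} \<subseteq> {i}"
    using assms i by (auto simp: disjoint_family_on_def)
  then show ?thesis using card_mono[of "{i}" "{i \<in> A. x \<in> I i}"] by simp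
qed

lemma card_disjoint_long_intervals:
  fixes s h :: "'i \<Rightarrow> real"
  assumes "finite A" "disjoint_family_on (\<lambda>i. {s i - h i..s i + h i}) A"
    and "\<And>i. i \<in> A \<Longrightarrow> h i \<ge> h0"
    and "\<And>i. i \<in> A \<Longrightarrow> {s i - h i..s i + h i} \<inter> {s0 - h0..s0 + h0} \<noteq> {}"
  shows "card A \<le> 2"
proof -
  \<comment> \<open>An interval at least as long as another one that it meets contains one of its endpoints.\<close>
  have "A \<subseteq> {i \<in> A. s0 - h0 \<in> {s i - h i..s i + h i}} \<union> {i \<in> A. s0 + h0 \<in> {s i - h i..s i + h i}}"
  proof
    fix i assume i: "i \<in> A"
    then obtain t where "t \<in> {s i - h i..s i + h i}" "t \<in> {s0 - h0..s0 + h0}"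
      using assms(4) by blast
    then show "i \<in> {i \<in> A. s0 - h0 \<in> {s i - h i..s i + h i}} \<union> {i \<in> A. s0 + h0 \<in> {s i - h i..s i + h i}}"
      using i assms(3)[OF i] by simp linarith
  qed
  then have "card A \<le> card ({i \<in> A. s0 - h0 \<in> {s i - h i..s i + h i}} \<union> {i \<in> A. s0 + h0 \<in> {s i - h i..s i + h i}})"
    using assms(1) by (intro card_mono) auto
  also have "\<dots> \<le> 1 + 1"
    by (rule order_trans[OF card_Un_le]) (intro add_mono card_disjoint_family_point[OF assms(2)])
  finally show ?thesis by simp
qed

text \<open>\<open>Suc m\<close> comes from the rank expansion and \<open>2 ^ m\<close> from the two
  strips charged to each selected box; \<open>6\<close> is the height \<open>2 * w\<close> times the
  packing radius \<open>3 * L j\<close>, in units of \<open>w * L j\<close>.\<close>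

definition overlap_const :: "nat \<Rightarrow> real" where
  "overlap_const m = 6 * Suc m * 2 ^ m * packing_const m"

lemma overlap_const_pos: "overlap_const m > 0"
  using packing_const_pos[of m] by (simp add: overlap_const_def)

text \<open>The rank expansion by length reduces the claim to one strip \<open>j\<close> and the
  strips no longer than it. On the strip of \<open>j\<close> their number is at most twice a
  function of the first coordinate, to which the packing lemma applies. One of the
  \<open>Suc m\<close> powers is spent on the sum over \<open>j\<close>, so only \<open>m\<close>
  factors \<open>1 / d\<close> appear.\<close>

lemma overlap_power_integral:
  fixes c a s L :: "'i \<Rightarrow> real" and E :: "'i \<Rightarrow> real set"
  assumes fin: "finite G" and d: "d > 0" and w: "w > 0"
    and L: "\<And>i. i \<in> G \<Longrightarrow> L i > 0"
    and Em: "\<And>i. i \<in> G \<Longrightarrow> E i \<in> sets lebesgue"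
    and EJ: "\<And>i. i \<in> G \<Longrightarrow> E i \<subseteq> {c i - L i..c i + L i}"
    and Eu: "\<And>i. i \<in> G \<Longrightarrow> u ` E i \<subseteq> {s i - w / L i..s i + w / L i}"
    and dens: "\<And>i. i \<in> G \<Longrightarrow> emeasure lebesgue (E i) \<ge> ennreal (d * L i)"
    and sep: "\<And>i j. i \<in> G \<Longrightarrow> j \<in> G \<Longrightarrow> i \<noteq> j \<Longrightarrow>
        strip (c i) (a i) (s i) (L i) w \<inter> strip (c j) (a j) (s j) (L j) w \<noteq> {} \<Longrightarrow>
        {s i - w / L i..s i + w / L i} \<inter> {s j - w / L j..s j + w / L j} = {}"
  shows "(\<integral>\<^sup>+z. of_nat (card {i \<in> G. z \<in> strip (c i) (a i) (s i) (L i) w} ^ Suc m) \<partial>lborel)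
           \<le> ennreal (overlap_const m / d ^ m * (\<Sum>i\<in>G. w * L i))"
proof -
  define P where "P = (\<lambda>i. strip (c i) (a i) (s i) (L i) w)"
  define J where "J = (\<lambda>i. {c i - L i..c i + L i})"
  define W where "W = (\<lambda>i. {s i - w / L i..s i + w / L i})"
  have [measurable]: "P i \<in> sets borel" for i by (simp add: P_def)
  have PJ: "fst z \<in> J i" if "z \<in> P i" for z i
    using that by (auto simp: P_def J_def strip_def abs_le_iff)
  define N where "N = (\<lambda>j z. {i \<in> G. z \<in> P i \<and> L i \<le> L j})"
  have measN: "(\<lambda>z. of_nat (card (N j z) ^ k) :: ennreal) \<in> borel_measurable borel" for j k
  proof -
    have "of_nat (card (N j z)) = (\<Sum>i\<in>{i\<in>G. L i \<le> L j}. indicator (P i) z :: ennreal)" for z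
    proof -
      have "(\<Sum>i\<in>{i\<in>G. L i \<le> L j}. indicator (P i) z :: ennreal) = (\<Sum>i\<in>N j z. 1)"
        using fin by (intro sum.mono_neutral_cong_right) (auto simp: indicator_def N_def)
      then show ?thesis by simp
    qed
    then show ?thesis unfolding of_nat_power by simp
  qed
  have each: "(\<integral>\<^sup>+z. of_nat (card (N j z) ^ m) * indicator (P j) z \<partial>lborel)
      \<le> ennreal (6 * 2 ^ m * packing_const m / d ^ m * (w * L j))" if j: "j \<in> G" for j
  proof -
    define A where "A = {i \<in> G. L i \<le> L j \<and> J i \<inter> J j \<noteq> {}}"
    have A: "A \<subseteq> G" "finite A" using fin by (auto simp: A_def)
    have ne: "J i \<noteq> {}" "W i \<noteq> {}" if "i \<in> A" for i
      using L[of i] that A w by (auto simp: J_def W_def)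
    \<comment> \<open>Conflict means that the boxes \<open>J \<times> W\<close> meet, and longer
      intervals are preferred.\<close>
    obtain T where T: "T \<subseteq> A"
      and Tsep: "\<And>x y. x \<in> T \<Longrightarrow> y \<in> T \<Longrightarrow> x \<noteq> y \<Longrightarrow> \<not> (J x \<inter> J y \<noteq> {} \<and> W x \<inter> W y \<noteq> {})"
      and cov: "\<And>x. x \<in> A \<Longrightarrow> \<exists>y\<in>T. (J x \<inter> J y \<noteq> {} \<and> W x \<inter> W y \<noteq> {}) \<and> L x \<le> L y"
    proof (rule greedy_selection[OF A(2), of "\<lambda>x y. J x \<inter> J y \<noteq> {} \<and> W x \<inter> W y \<noteq> {}" L])
    qed (use ne in \<open>simp_all add: Int_commute\<close>)
    have TG: "T \<subseteq> G" and finT: "finite T"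
      using T A by (simp_all add: subset_trans finite_subset[OF T A(2)])
    have pt: "card (N j z) \<le> 2 * card {i \<in> T. \<bar>fst z - c i\<bar> \<le> 3 * L i}" if z: "z \<in> P j" for z
    proof -
      \<comment> \<open>Each strip through \<open>z\<close> is charged to a selected box that covers
        it. As its interval contains \<open>fst z\<close>, meets \<open>J t\<close> and is no longer
        than \<open>J t\<close>, the point \<open>fst z\<close> lies in the triple of
        \<open>J t\<close>.\<close>
      define B where "B = (\<lambda>t. {i \<in> N j z. W i \<inter> W t \<noteq> {} \<and> L i \<le> L t})"
      let ?T = "{i \<in> T. \<bar>fst z - c i\<bar> \<le> 3 * L i}"
      have NA: "N j z \<subseteq> A"
      proof
        fix i assume "i \<in> N j z"
        then have "i \<in> G" "z \<in> P i" "L i \<le> L j" by (simp_all add: N_def)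
        moreover have "fst z \<in> J i \<inter> J j" using PJ z \<open>z \<in> P i\<close> by simp
        ultimately show "i \<in> A" unfolding A_def by blast
      qed
      have "N j z \<subseteq> (\<Union>t\<in>?T. B t)"
      proof
        fix i assume i: "i \<in> N j z"
        then obtain t where t: "t \<in> T" "J i \<inter> J t \<noteq> {}" "W i \<inter> W t \<noteq> {}" "L i \<le> L t"
          using cov NA by blast
        have "fst z \<in> J i" using i PJ by (auto simp: N_def)
        moreover obtain x where "x \<in> J i" "x \<in> J t" using t(2) by blast
        ultimately have "\<bar>fst z - c t\<bar> \<le> 3 * L t"
          using t(4) by (auto simp: J_def abs_le_iff)
        then show "i \<in> (\<Union>t\<in>?T. B t)" using t i by (auto simp: B_def)
      qed
      then have "card (N j z) \<le> card (\<Union>t\<in>?T. B t)"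
        using fin finT by (intro card_mono) (auto simp: B_def N_def)
      also have "\<dots> \<le> (\<Sum>t\<in>?T. card (B t))" using finT by (intro card_UN_le) auto
      also have "\<dots> \<le> (\<Sum>t\<in>?T. 2)"
      proof (intro sum_mono)
        fix t assume "t \<in> ?T"
        then have tG: "t \<in> G" using TG by auto
        \<comment> \<open>All strips charged to \<open>t\<close> contain \<open>z\<close>, so
          \<open>sep\<close> makes their slope windows disjoint. The half-width
          \<open>w / L i\<close> decreases in the length, so these windows are at least as wide as
          \<open>W t\<close>.\<close>
        show "card (B t) \<le> 2"
        proof (rule card_disjoint_long_intervals)
          show "finite (B t)" using fin by (auto simp: B_def N_def)
          show "disjoint_family_on (\<lambda>i. {s i - w / L i..s i + w / L i}) (B t)"
            using sep unfolding disjoint_family_on_def B_def N_def P_def by blast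
          fix i assume i: "i \<in> B t"
          then have "0 < L i" "L i \<le> L t" using L by (auto simp: B_def N_def)
          then show "w / L t \<le> w / L i" using w by (intro divide_left_mono) auto
          show "{s i - w / L i..s i + w / L i} \<inter> {s t - w / L t..s t + w / L t} \<noteq> {}"
            using i by (simp add: B_def W_def)
        qed
      qed
      finally show ?thesis by simp
    qed
    \<comment> \<open>A common point \<open>q\<close> would place \<open>(q, u q)\<close> in both
      boxes.\<close>
    have "disjoint_family_on E T"
    proof (unfold disjoint_family_on_def, intro ballI impI)
      fix x y assume xy: "x \<in> T" "y \<in> T" "x \<noteq> y"
      then have "E x \<subseteq> J x" "E y \<subseteq> J y" "u ` E x \<subseteq> W x" "u ` E y \<subseteq> W y"
        using TG EJ Eu unfolding J_def W_def by blast+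
      then show "E x \<inter> E y = {}" using Tsep[OF xy] by blast
    qed
    moreover have "{c i - L i..c i + L i} \<subseteq> {c j - 3 * L j..c j + 3 * L j}" if "i \<in> T" for i
    proof -
      have "L i \<le> L j" "J i \<inter> J j \<noteq> {}" using that T by (auto simp: A_def)
      then show ?thesis by (auto simp: J_def)
    qed
    \<comment> \<open>The packing lemma is applied with \<open>r = 3 * L j\<close>, as the triple of
      \<open>J j\<close> contains all intervals of \<open>T\<close>. The integral then runs over
      radius \<open>9 * L j\<close>, which covers \<open>J j\<close>.\<close>
    ultimately have pack: "(\<integral>\<^sup>+x. of_nat (card {i \<in> T. \<bar>x - c i\<bar> \<le> 3 * L i} ^ m) *
          indicator {c j - 3 * (3 * L j)..c j + 3 * (3 * L j)} x \<partial>lborel)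
        \<le> ennreal (packing_const m / d ^ m * (3 * L j))"
      using TG L[OF j] by (intro packing_power_integral[OF finT d L Em EJ dens]) auto
    have cm: "(\<lambda>x. of_nat (card {i \<in> T. \<bar>x - c i\<bar> \<le> 3 * L i}) :: ennreal) \<in> borel_measurable borel"
    proof -
      have "of_nat (card {i \<in> T. \<bar>x - c i\<bar> \<le> 3 * L i}) =
         (\<Sum>i\<in>T. indicator {x. \<bar>x - c i\<bar> \<le> 3 * L i} x :: ennreal)" for x
      proof -
        have "(\<Sum>i\<in>T. indicator {x. \<bar>x - c i\<bar> \<le> 3 * L i} x :: ennreal) = (\<Sum>i\<in>{i \<in> T. \<bar>x - c i\<bar> \<le> 3 * L i}. 1)"
          using finT by (intro sum.mono_neutral_cong_right) (auto simp: indicator_def)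
        then show ?thesis by simp
      qed
      then show ?thesis by simp
    qed
    have cm_pow: "(\<lambda>x. of_nat (card {i \<in> T. \<bar>x - c i\<bar> \<le> 3 * L i} ^ m) :: ennreal) \<in> borel_measurable borel"
      unfolding of_nat_power by (intro borel_measurable_power_ennreal cm)
    have "(\<integral>\<^sup>+z. of_nat (card (N j z) ^ m) * indicator (P j) z \<partial>lborel) \<le>
        (\<integral>\<^sup>+z. (2 ^ m * of_nat (card {i \<in> T. \<bar>fst z - c i\<bar> \<le> 3 * L i} ^ m)) * indicator (P j) z \<partial>lborel)"
    proof (intro nn_integral_mono)
      fix z
      show "of_nat (card (N j z) ^ m) * indicator (P j) z
        \<le> (2 ^ m * of_nat (card {i \<in> T. \<bar>fst z - c i\<bar> \<le> 3 * L i} ^ m)) * (indicator (P j) z :: ennreal)"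
      proof (cases "z \<in> P j")
        case True
        have "(of_nat (card (N j z) ^ m) :: ennreal) \<le> of_nat ((2 * card {i \<in> T. \<bar>fst z - c i\<bar> \<le> 3 * L i}) ^ m)"
          by (intro of_nat_mono power_mono pt[OF True]) simp
        then show ?thesis using True by (simp add: power_mult_distrib)
      qed simp
    qed
    also have "\<dots> = ennreal (2 * w) * (\<integral>\<^sup>+x. 2 ^ m * of_nat (card {i \<in> T. \<bar>x - c i\<bar> \<le> 3 * L i} ^ m) * indicator {c j - L j..c j + L j} x \<partial>lborel)"
      unfolding P_def using w by (intro nn_integral_strip borel_measurable_times_ennreal cm_pow) simp_all
    also have "\<dots> \<le> ennreal (2 * w) * (\<integral>\<^sup>+x. 2 ^ m * (of_nat (card {i \<in> T. \<bar>x - c i\<bar> \<le> 3 * L i} ^ m) *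
          indicator {c j - 3 * (3 * L j)..c j + 3 * (3 * L j)} x) \<partial>lborel)"
      using L[OF j] by (intro mult_left_mono nn_integral_mono) (auto simp: indicator_def)
    also have "\<dots> = ennreal (2 * w) * (2 ^ m * (\<integral>\<^sup>+x. of_nat (card {i \<in> T. \<bar>x - c i\<bar> \<le> 3 * L i} ^ m) *
          indicator {c j - 3 * (3 * L j)..c j + 3 * (3 * L j)} x \<partial>lborel))"
      by (intro arg_cong2[where f = "(*)"] refl nn_integral_cmult)
        (simp only: measurable_lborel1 measurable_lborel2, intro borel_measurable_times_ennreal cm_pow borel_measurable_indicator borel_closed closed_atLeastAtMost)
    also have "\<dots> \<le> ennreal (2 * w) * (2 ^ m * ennreal (packing_const m / d ^ m * (3 * L j)))"
      by (intro mult_left_mono pack) auto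
    also have "\<dots> = ennreal (2 * w * (2 ^ m * (packing_const m / d ^ m * (3 * L j))))"
      using w L[OF j] d packing_const_pos[of m]
      by (simp only: ennreal_mult' ennreal_power[symmetric] ennreal_numeral[symmetric] zero_le_numeral zero_le_power)
    also have "2 * w * (2 ^ m * (packing_const m / d ^ m * (3 * L j))) = 6 * 2 ^ m * packing_const m / d ^ m * (w * L j)"
      by simp
    finally show ?thesis .
  qed
  have pt: "of_nat (card {i \<in> G. z \<in> P i} ^ Suc m) \<le>
      (\<Sum>j\<in>G. of_nat (Suc m) * (of_nat (card (N j z) ^ m) * (indicator (P j) z :: ennreal)))" for z
  proof -
    let ?A = "{i \<in> G. z \<in> P i}"
    have N: "{i \<in> ?A. L i \<le> L j} = N j z" for j by (auto simp: N_def)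
    have "card ?A ^ Suc m \<le> Suc m * (\<Sum>i\<in>?A. card (N i z) ^ m)"
      using card_power_le_sum_ranks[of ?A m L] fin unfolding N by simp
    then have "(of_nat (card ?A ^ Suc m) :: ennreal) \<le> of_nat (Suc m * (\<Sum>i\<in>?A. card (N i z) ^ m))"
      by (rule of_nat_mono)
    also have "\<dots> = (\<Sum>i\<in>?A. of_nat (Suc m) * of_nat (card (N i z) ^ m))"
      by (simp only: of_nat_mult of_nat_sum sum_distrib_left)
    also have "\<dots> = (\<Sum>j\<in>G. of_nat (Suc m) * (of_nat (card (N j z) ^ m) * indicator (P j) z))"
      using fin by (intro sum.mono_neutral_cong_left) auto
    finally show ?thesis .
  qed
  have "(\<integral>\<^sup>+z. of_nat (card {i \<in> G. z \<in> P i} ^ Suc m) \<partial>lborel) \<le>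
     (\<integral>\<^sup>+z. (\<Sum>j\<in>G. of_nat (Suc m) * (of_nat (card (N j z) ^ m) * indicator (P j) z)) \<partial>lborel)"
    by (intro nn_integral_mono pt)
  also have "\<dots> = (\<Sum>j\<in>G. of_nat (Suc m) * (\<integral>\<^sup>+z. of_nat (card (N j z) ^ m) * indicator (P j) z \<partial>lborel))"
    using measN by (subst nn_integral_sum) (auto intro!: sum.cong nn_integral_cmult simp del: of_nat_power of_nat_Suc)
  also have "\<dots> \<le> (\<Sum>j\<in>G. of_nat (Suc m) * ennreal (6 * 2 ^ m * packing_const m / d ^ m * (w * L j)))"
    by (intro sum_mono mult_left_mono each) auto
  also have "\<dots> = (\<Sum>j\<in>G. ennreal (Suc m * (6 * 2 ^ m * packing_const m / d ^ m * (w * L j))))"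
    by (intro sum.cong refl) (simp only: ennreal_mult' ennreal_of_nat_eq_real_of_nat of_nat_0_le_iff)
  also have "\<dots> = ennreal (\<Sum>j\<in>G. Suc m * (6 * 2 ^ m * packing_const m / d ^ m * (w * L j)))"
    using packing_const_pos[of m] L d w by (intro sum_ennreal) (auto simp: less_imp_le)
  also have "(\<Sum>j\<in>G. Suc m * (6 * 2 ^ m * packing_const m / d ^ m * (w * L j))) = overlap_const m / d ^ m * (\<Sum>j\<in>G. w * L j)"
    unfolding overlap_const_def sum_distrib_left by (intro sum.cong refl) (simp add: mult_ac)
  finally show ?thesis unfolding P_def .
qed

text \<open>The strips share a point, and their slopes differ by at most \<open>2 * (w / L)\<close>.
  Over a horizontal distance of at most \<open>3 * L\<close> the difference of slopes contributes
  \<open>6 * w\<close>; the deviations of \<open>z\<close> and of the common point add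
  \<open>2 * w + w + w\<close>. Horizontally, \<open>2 * L + L + L' \<le> 4 * L'\<close>.\<close>

lemma strip_dilate_subset:
  assumes meet: "strip c a s L w \<inter> strip c' a' s' L' w \<noteq> {}"
    and slopes: "{s - w / L..s + w / L} \<inter> {s' - w / L'..s' + w / L'} \<noteq> {}"
    and L: "0 < L" "L \<le> L'" and w: "0 < w"
  shows "strip c a s (2 * L) (2 * w) \<subseteq> strip c' a' s' (4 * L') (10 * w)"
proof
  fix z assume "z \<in> strip c a s (2 * L) (2 * w)"
  then obtain x y where z: "z = (x, y)" and x: "\<bar>x - c\<bar> \<le> 2 * L" and y: "\<bar>y - a - s * (x - c)\<bar> \<le> 2 * w"
    by (cases z) (auto simp: strip_def)
  from meet obtain x0 y0 where x0: "\<bar>x0 - c\<bar> \<le> L" "\<bar>x0 - c'\<bar> \<le> L'"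
    and y0: "\<bar>y0 - a - s * (x0 - c)\<bar> \<le> w" "\<bar>y0 - a' - s' * (x0 - c')\<bar> \<le> w"
    by (auto simp: strip_def)
  have "w / L' \<le> w / L" using L w by (intro divide_left_mono) auto
  then have s: "\<bar>s - s'\<bar> \<le> 2 * (w / L)" using slopes by auto
  have "\<bar>(s - s') * (x - x0)\<bar> \<le> (2 * (w / L)) * (3 * L)"
    unfolding abs_mult using s x x0 by (intro mult_mono) auto
  also have "\<dots> = 6 * w" using L by simp
  finally have "\<bar>(s - s') * (x - x0)\<bar> \<le> 6 * w" .
  moreover have "y - a' - s' * (x - c') = (y - a - s * (x - c)) - (y0 - a - s * (x0 - c)) +
      (y0 - a' - s' * (x0 - c')) + (s - s') * (x - x0)" by (simp add: algebra_simps)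
  moreover have "\<bar>p - q + r + t\<bar> \<le> 10 * w"
    if "\<bar>p\<bar> \<le> 2 * w" "\<bar>q\<bar> \<le> w" "\<bar>r\<bar> \<le> w" "\<bar>t\<bar> \<le> 6 * w" for p q r t
    using that unfolding abs_le_iff by linarith
  ultimately have "\<bar>y - a' - s' * (x - c')\<bar> \<le> 10 * w" using y y0 by metis
  moreover have "\<bar>x - c'\<bar> \<le> 4 * L'" using x x0 L unfolding abs_le_iff by linarith
  ultimately show "z \<in> strip c' a' s' (4 * L') (10 * w)" by (simp add: strip_def z)
qed

subsection \<open>Rectangles and strips\<close>

lemma compact_rect: "compact (rect c th L w)"
proof -
  let ?f = "\<lambda>p. (fst c + fst p * cos th - snd p * sin th, snd c + fst p * sin th + snd p * cos th)"
  have "compact (?f ` ({- (L / 2)..L / 2} \<times> {- (w / 2)..w / 2}))"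
    by (intro compact_continuous_image continuous_intros compact_Times compact_Icc)
  moreover have "rect c th L w = ?f ` ({- (L / 2)..L / 2} \<times> {- (w / 2)..w / 2})" (is "_ = ?R")
  proof (rule set_eqI, rule iffI)
    fix z assume "z \<in> rect c th L w"
    then obtain s t where "z = (fst c + s * cos th - t * sin th, snd c + s * sin th + t * cos th)"
      "\<bar>s\<bar> \<le> L / 2" "\<bar>t\<bar> \<le> w / 2" unfolding rect_def by blast
    then show "z \<in> ?R" by (intro image_eqI[of _ _ "(s, t)"]) (simp_all, linarith)
  next
    fix z assume "z \<in> ?R"
    then obtain s t where "z = ?f (s, t)" "\<bar>s\<bar> \<le> L / 2" "\<bar>t\<bar> \<le> w / 2"
      by (force simp: abs_le_iff)
    then show "z \<in> rect c th L w" unfolding rect_def by auto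
  qed
  ultimately show ?thesis by (simp only:)
qed

text \<open>A point at distance \<open>t\<close> from the long axis deviates from it vertically by
  \<open>t / cos th\<close>, at most \<open>w\<close> when the cosine is at least
  \<open>1 / 2\<close>. The horizontal extent is at most \<open>L / 2 + w / 2\<close>.\<close>

lemma rect_subset_strip:
  assumes "1 / 2 \<le> \<bar>cos th\<bar>" "0 \<le> w" "w \<le> L"
  shows "rect c th L w \<subseteq> strip (fst c) (snd c) (tan th) L w"
proof
  fix z assume "z \<in> rect c th L w"
  then obtain s t where z: "z = (fst c + s * cos th - t * sin th, snd c + s * sin th + t * cos th)"
    and st: "\<bar>s\<bar> \<le> L / 2" "\<bar>t\<bar> \<le> w / 2" by (auto simp: rect_def)
  have cos0: "cos th \<noteq> 0" using assms(1) by auto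
  have "\<bar>s * cos th\<bar> \<le> L / 2 * 1" "\<bar>t * sin th\<bar> \<le> w / 2 * 1"
    unfolding abs_mult using st assms by (intro mult_mono; simp)+
  then have "\<bar>s * cos th - t * sin th\<bar> \<le> L" using assms(3) by linarith
  moreover have "s * sin th + t * cos th - tan th * (s * cos th - t * sin th) = t * (((cos th)\<^sup>2 + (sin th)\<^sup>2) / cos th)"
    using cos0 by (simp add: tan_def field_simps power2_eq_square del: sin_cos_squared_add sin_cos_squared_add2 sin_cos_squared_add3)
  then have "\<bar>s * sin th + t * cos th - tan th * (s * cos th - t * sin th)\<bar> = \<bar>t\<bar> / \<bar>cos th\<bar>"
    by (simp add: abs_mult)
  moreover have "\<bar>t\<bar> / \<bar>cos th\<bar> \<le> (w / 2) / (1 / 2)"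
    using st assms by (intro frac_le) auto
  ultimately show "z \<in> strip (fst c) (snd c) (tan th) L w"
    by (simp add: strip_def z algebra_simps)
qed

text \<open>The horizontal radius carries the factor \<open>\<bar>cos th\<bar>\<close> because
  moving along the axis by \<open>s\<close> changes the first coordinate by
  \<open>s * cos th\<close>. The inscribed strip bounds the area of the rectangle from below up to a
  constant, which suffices here.\<close>

lemma strip_subset_rect:
  assumes "cos th \<noteq> 0" "0 \<le> w" "w \<le> L"
  shows "strip (fst c) (snd c) (tan th) (\<bar>cos th\<bar> * L / 4) (w / 4) \<subseteq> rect c th L w"
proof
  fix z assume z: "z \<in> strip (fst c) (snd c) (tan th) (\<bar>cos th\<bar> * L / 4) (w / 4)"
  define X e where "X = fst z - fst c" and "e = snd z - snd c - tan th * X"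
  have X: "\<bar>X\<bar> \<le> \<bar>cos th\<bar> * L / 4" and e: "\<bar>e\<bar> \<le> w / 4"
    using z by (auto simp: strip_def X_def e_def)
  \<comment> \<open>These invert the rotated coordinates for the horizontal offset \<open>X\<close>
    and the vertical deviation \<open>e\<close> from the axis.\<close>
  define s t where "s = X / cos th + e * sin th" and "t = e * cos th"
  have "\<bar>X / cos th\<bar> \<le> L / 4" using X assms(1) by (simp add: abs_divide field_simps)
  moreover have es: "\<bar>e * sin th\<bar> \<le> w / 4 * 1" "\<bar>e * cos th\<bar> \<le> w / 4 * 1"
    unfolding abs_mult using e assms by (intro mult_mono; simp)+
  ultimately have "\<bar>s\<bar> \<le> L / 2" unfolding s_def using assms(3) by linarith
  moreover have "\<bar>t\<bar> \<le> w / 2" unfolding t_def using es(2) assms(2) by linarith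
  moreover have "s * cos th - t * sin th = X" using assms(1) by (simp add: s_def t_def field_simps)
  moreover have "s * sin th + t * cos th = tan th * X + e * ((sin th)\<^sup>2 + (cos th)\<^sup>2)"
    using assms(1) by (simp add: s_def t_def tan_def field_simps power2_eq_square del: sin_cos_squared_add sin_cos_squared_add2 sin_cos_squared_add3)
  then have "s * sin th + t * cos th = snd z - snd c" by (simp add: e_def)
  ultimately have "\<bar>s\<bar> \<le> L / 2" "\<bar>t\<bar> \<le> w / 2"
      "z = (fst c + s * cos th - t * sin th, snd c + s * sin th + t * cos th)"
    by (simp_all add: X_def prod_eq_iff algebra_simps)
  then show "z \<in> rect c th L w" unfolding rect_def by blast
qed

lemma measure_rect_ge:
  assumes "cos th \<noteq> 0" "0 \<le> w" "w \<le> L"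
  shows "measure lebesgue (rect c th L w) \<ge> \<bar>cos th\<bar> * L * w / 4"
proof -
  have "measure lebesgue (strip (fst c) (snd c) (tan th) (\<bar>cos th\<bar> * L / 4) (w / 4)) \<le> measure lebesgue (rect c th L w)"
    by (intro measure_mono_fmeasurable strip_subset_rect assms lmeasurable_compact compact_rect)
      (simp add: sets_strip)
  moreover have "emeasure lborel (strip (fst c) (snd c) (tan th) (\<bar>cos th\<bar> * L / 4) (w / 4)) = ennreal (\<bar>cos th\<bar> * L * w / 4)"
    using assms by (subst emeasure_strip) simp_all
  then have "measure lebesgue (strip (fst c) (snd c) (tan th) (\<bar>cos th\<bar> * L / 4) (w / 4)) = \<bar>cos th\<bar> * L * w / 4"
    using assms by (simp add: measure_def sets_strip)
  ultimately show ?thesis by simp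
qed

text \<open>Here the two-dimensional density of \<open>Vset\<close> becomes a one-dimensional
  density of \<open>E\<close>. \<open>Vset\<close> lies above \<open>E\<close> inside a strip of
  height \<open>2 * w\<close>, so its measure is at most \<open>2 * w\<close> times that of
  \<open>E\<close>, while the rectangle has area at least \<open>L * w / 8\<close> once the cosine
  is bounded below. The quotient is \<open>\<delta> / 16 * L\<close>.\<close>

lemma rect_dense_slopes:
  fixes c th L w u
  defines "E \<equiv> {x \<in> {0..1} \<inter> {fst c - L..fst c + L}. u x \<in> EX_int th L w}"
  assumes u: "u \<in> borel_measurable (lebesgue_on {0..1})" "\<And>x. x \<in> {0..1} \<Longrightarrow> u x \<in> {0..1}"
    and pos: "0 < \<delta>" "0 < w" "w \<le> L" "cos th \<noteq> 0"
    and dens: "measure lebesgue (Vset u c th L w) \<ge> \<delta> * measure lebesgue (rect c th L w)"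
  shows "1 / 2 \<le> \<bar>cos th\<bar>" and "E \<in> sets lebesgue" and "emeasure lebesgue E \<ge> ennreal (\<delta> / 16 * L)"
proof -
  have rect_ge: "measure lebesgue (rect c th L w) \<ge> \<bar>cos th\<bar> * L * w / 4"
    by (rule measure_rect_ge[OF pos(4) less_imp_le[OF pos(2)] pos(3)])
  have L: "0 < L" using pos(2,3) by linarith
  have "0 < \<bar>cos th\<bar> * L * w / 4"
    by (intro divide_pos_pos mult_pos_pos L pos(2)) (simp_all add: pos(4))
  with rect_ge have "0 < measure lebesgue (rect c th L w)" by (rule order.strict_trans2[rotated])
  then have "0 < \<delta> * measure lebesgue (rect c th L w)" by (rule mult_pos_pos[OF pos(1)])
  then have "measure lebesgue (Vset u c th L w) \<noteq> 0" using dens by linarith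
  \<comment> \<open>One point of \<open>Vset\<close> bounds the slope: \<open>u x\<close> lies in
    \<open>{0..1}\<close> and within \<open>1 / 2\<close> of \<open>tan th\<close>, as
    \<open>w \<le> L\<close>.\<close>
  then have "Vset u c th L w \<noteq> {}" by (metis measure_empty)
  then obtain x where "x \<in> {0..1}" "u x \<in> EX_int th L w" by (auto simp: Vset_def)
  moreover have "w / (2 * L) \<le> 1 / 2" using pos by (simp add: field_simps)
  moreover have "0 \<le> u x" "u x \<le> 1" using u(2)[OF \<open>x \<in> {0..1}\<close>] by simp_all
  ultimately have tan: "\<bar>tan th\<bar> \<le> 3 / 2"
    unfolding EX_int_def atLeastAtMost_iff abs_le_iff by linarith
  have "(1 / 2)\<^sup>2 \<le> (cos th)\<^sup>2"
  proof -
    have "\<bar>sin th\<bar> \<le> 3 / 2 * \<bar>cos th\<bar>" using tan pos(4) by (simp add: tan_def abs_divide field_simps)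
    then have "\<bar>sin th\<bar>\<^sup>2 \<le> (3 / 2 * \<bar>cos th\<bar>)\<^sup>2" by (intro power_mono) auto
    then have "(sin th)\<^sup>2 \<le> 9 / 4 * (cos th)\<^sup>2" by (simp add: power_mult_distrib power2_eq_square)
    then have "1 \<le> 4 * (cos th)\<^sup>2" using sin_cos_squared_add[of th] zero_le_power2[of "cos th"] by linarith
    then show ?thesis by (simp add: power2_eq_square)
  qed
  then show cos: "1 / 2 \<le> \<bar>cos th\<bar>" by (simp add: abs_le_square_iff[symmetric])
  have "u -` EX_int th L w \<inter> space (lebesgue_on {0..1}) \<in> sets (lebesgue_on {0..1})"
    by (rule measurable_sets[OF u(1)]) (simp add: EX_int_def)
  then have "u -` EX_int th L w \<inter> {0..1} \<in> sets lebesgue"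
    by (simp add: sets_restrict_space_iff space_restrict_space)
  then have "(u -` EX_int th L w \<inter> {0..1}) \<inter> {fst c - L..fst c + L} \<in> sets lebesgue"
    by (rule sets.Int) simp
  moreover have "(u -` EX_int th L w \<inter> {0..1}) \<inter> {fst c - L..fst c + L} = E"
    by (auto simp: E_def)
  ultimately show E: "E \<in> sets lebesgue" by (simp only:)
  have "E \<subseteq> {0..1}" by (auto simp: E_def)
  then have Elm: "E \<in> lmeasurable"
    using E by (rule fmeasurableI2[OF lmeasurable_compact[OF compact_Icc]])
  \<comment> \<open>\<open>E\<close> is replaced by an open superset \<open>T\<close> of nearly the
    same measure, so that the part of the strip above \<open>T\<close> is Borel.\<close>
  have "\<delta> / 16 * L \<le> measure lebesgue E + \<epsilon>" if eps: "\<epsilon> > 0" for \<epsilon>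
  proof -
    obtain T where T0: "open T" "E \<subseteq> T" "T - E \<in> lmeasurable" "emeasure lebesgue (T - E) < ennreal \<epsilon>"
      by (rule sets_lebesgue_outer_open[OF E eps])
    have "T = E \<union> (T - E)" using T0(2) by blast
    then have Tlm: "T \<in> lmeasurable" using fmeasurable.Un[OF Elm T0(3)] by simp
    have "measure lebesgue T = measure lebesgue E + measure lebesgue (T - E)"
      using measure_Un2[OF Elm Tlm] T0(2) by (simp add: Un_absorb1)
    moreover have "measure lebesgue (T - E) < \<epsilon>"
      using T0(4) eps by (simp only: emeasure_eq_measure2[OF T0(3)] ennreal_less_iff measure_nonneg)
    ultimately have T: "open T" "E \<subseteq> T" "T \<in> lmeasurable" "measure lebesgue T < measure lebesgue E + \<epsilon>"
      using T0 Tlm by linarith+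
    let ?S = "strip (fst c) (snd c) (tan th) L w"
    have [measurable]: "T \<in> sets borel" using T by auto
    have Tm: "emeasure lborel T = ennreal (measure lebesgue T)"
      using emeasure_eq_measure2[OF T(3)] T by simp
    have "Vset u c th L w \<subseteq> (fst -` T) \<inter> ?S"
    proof
      fix z assume z: "z \<in> Vset u c th L w"
      then have S: "z \<in> ?S" using rect_subset_strip[OF cos, of w L c] pos by (auto simp: Vset_def)
      then have "fst z \<in> E" using z by (auto simp: E_def Vset_def strip_def abs_le_iff)
      then show "z \<in> (fst -` T) \<inter> ?S" using S T by auto
    qed
    moreover have mT: "(fst -` T) \<inter> ?S \<in> sets borel"
      using T(1) by (intro sets.Int sets_strip borel_open open_vimage_fst)
    ultimately have "emeasure lebesgue (Vset u c th L w) \<le> emeasure lebesgue ((fst -` T) \<inter> ?S)"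
      by (intro emeasure_mono sets_completionI_sets) (simp_all only: sets_lborel)
    also have "\<dots> = emeasure lborel ((fst -` T) \<inter> ?S)"
      using mT by simp
    also have "\<dots> = (\<integral>\<^sup>+z. indicator T (fst z) * indicator ?S z \<partial>lborel)"
    proof -
      have "indicator T (fst z) * indicator ?S z = (indicator ((fst -` T) \<inter> ?S) z :: ennreal)" for z
        by (simp add: indicator_def)
      then show ?thesis using mT by simp
    qed
    also have "\<dots> = ennreal (2 * w) * (\<integral>\<^sup>+x. indicator T x * indicator {fst c - L..fst c + L} x \<partial>lborel)"
      using pos by (intro nn_integral_strip) auto
    also have "\<dots> \<le> ennreal (2 * w) * (\<integral>\<^sup>+x. indicator T x \<partial>lborel)"
      by (intro mult_left_mono nn_integral_mono) (auto simp: indicator_def)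
    also have "\<dots> = ennreal (2 * w * measure lebesgue T)"
      using pos by (simp add: Tm ennreal_mult)
    finally have "measure lebesgue (Vset u c th L w) \<le> 2 * w * measure lebesgue T"
      unfolding measure_def[of lebesgue "Vset u c th L w"] using pos by (intro enn2real_leI) auto
    moreover have "\<delta> * (1 / 2 * L * w / 4) \<le> \<delta> * measure lebesgue (rect c th L w)"
    proof (intro mult_left_mono order_trans[OF _ rect_ge])
      show "1 / 2 * L * w / 4 \<le> \<bar>cos th\<bar> * L * w / 4"
        using pos cos by (intro divide_right_mono mult_right_mono) auto
    qed (use pos in auto)
    ultimately have "w * (\<delta> / 16 * L) \<le> w * measure lebesgue T" using dens by (simp add: mult_ac)
    then have "\<delta> / 16 * L \<le> measure lebesgue T" using pos by simp
    then show ?thesis using T(4) by linarith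
  qed
  then have "\<delta> / 16 * L \<le> measure lebesgue E" by (rule field_le_epsilon)
  then show "emeasure lebesgue E \<ge> ennreal (\<delta> / 16 * L)"
    by (subst emeasure_eq_measure2[OF Elm]) (rule ennreal_leI)
qed

subsection \<open>The weak type estimate\<close>

text \<open>A form of Young's inequality for the conjugate exponents \<open>Suc m\<close> and
  \<open>1 + 1 / m\<close>: if \<open>x \<le> e * F ^ m\<close>, the first term dominates; otherwise
  \<open>F\<close> is at most the m-th root of \<open>x / e\<close>. The parameter \<open>e\<close>
  is free so that the first term can be absorbed later.\<close>

lemma mult_le_powers:
  fixes F x e :: real
  assumes "0 \<le> F" "0 \<le> x" "0 < e" "m \<ge> 1"
  shows "F * x \<le> e * F ^ Suc m + e powr (- 1 / real m) * x powr (1 + 1 / real m)"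
proof (cases "x \<le> e * F ^ m")
  case True
  then have "F * x \<le> F * (e * F ^ m)" using assms by (intro mult_left_mono)
  moreover have "0 \<le> e powr (- 1 / real m) * x powr (1 + 1 / real m)"
    by (intro mult_nonneg_nonneg) simp_all
  moreover have "F * (e * F ^ m) = e * F ^ Suc m" by simp
  ultimately show ?thesis by linarith
next
  case False
  then have x: "x > 0" using assms by (meson le_less_trans mult_nonneg_nonneg not_le order.strict_implies_order zero_le_power)
  have "F \<le> (x / e) powr (1 / real m)"
  proof (cases "F = 0")
    case False
    then have "F = (F ^ m) powr (1 / real m)" using assms by (simp add: powr_realpow[symmetric] powr_powr)
    also have "\<dots> \<le> (x / e) powr (1 / real m)"
      using \<open>\<not> x \<le> e * F ^ m\<close> assms by (intro powr_mono2) (auto simp: field_simps)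
    finally show ?thesis .
  qed simp
  then have "F * x \<le> (x / e) powr (1 / real m) * x" using x by (intro mult_right_mono) auto
  also have "\<dots> = e powr (- 1 / real m) * x powr (1 + 1 / real m)"
  proof -
    have "x powr (1 + 1 / real m) = x * x powr (1 / real m)"
      using x by (simp only: powr_add powr_one less_imp_le)
    moreover have "e powr (- 1 / real m) = 1 / e powr (1 / real m)"
      by (simp add: powr_minus_divide[symmetric])
    ultimately show ?thesis using x assms by (simp add: powr_divide)
  qed
  finally show ?thesis using assms by (simp add: add_increasing)
qed

text \<open>Lindelof leaves countably many sets, and continuity from below leaves finite unions. The
  finite selection thereby serves uncountable families.\<close>

lemma emeasure_Union_open_le:
  fixes F :: "'a::euclidean_space set set"
  assumes op: "\<And>S. S \<in> F \<Longrightarrow> open S"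
    and fin: "\<And>F'. F' \<subseteq> F \<Longrightarrow> finite F' \<Longrightarrow> emeasure lborel (\<Union>F') \<le> B"
  shows "emeasure lborel (\<Union>F) \<le> B"
proof -
  obtain F' where F': "F' \<subseteq> F" "countable F'" "\<Union>F' = \<Union>F"
    using Lindelof[OF op] by metis
  show ?thesis
  proof (cases "F' = {}")
    case True
    then have "\<Union>F = {}" using F'(3) by (metis Union_empty)
    then show ?thesis by (simp only: emeasure_empty zero_le)
  next
    case False
    define X where "X = (\<lambda>n::nat. \<Union>(from_nat_into F' ` {..n}))"
    have sub: "from_nat_into F' ` {..n} \<subseteq> F" for n
      using from_nat_into[OF False] F'(1) by blast
    have "open (X n)" for n unfolding X_def using sub op by (intro open_Union) blast
    moreover have "incseq X" unfolding X_def by (intro incseq_SucI Union_mono image_mono) auto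
    ultimately have "(SUP n. emeasure lborel (X n)) = emeasure lborel (\<Union>n. X n)"
      by (intro SUP_emeasure_incseq) auto
    moreover have "(\<Union>n. X n) = \<Union>(range (from_nat_into F'))"
      unfolding X_def by auto
    moreover have "(SUP n. emeasure lborel (X n)) \<le> B"
      unfolding X_def by (intro SUP_least fin[OF sub]) simp
    ultimately show ?thesis by (simp only: range_from_nat_into[OF False F'(2)] F'(3))
  qed
qed

text \<open>Openness makes arbitrary unions measurable and accessible to Lindelof; the open strip of
  twice the size contains the closed one.\<close>

definition open_strip :: "real \<Rightarrow> real \<Rightarrow> real \<Rightarrow> real \<Rightarrow> real \<Rightarrow> (real \<times> real) set" where
  "open_strip c a s l b = {z. \<bar>fst z - c\<bar> < l \<and> \<bar>snd z - a - s * (fst z - c)\<bar> < b}"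

lemma open_open_strip: "open (open_strip c a s l b)"
  unfolding open_strip_def by (intro open_Collect_conj open_Collect_less continuous_intros)

lemma open_strip_subset: "open_strip c a s l b \<subseteq> strip c a s l b"
  by (auto simp: open_strip_def strip_def)

lemma strip_subset_open_strip:
  "l < l' \<Longrightarrow> b < b' \<Longrightarrow> strip c a s l b \<subseteq> open_strip c a s l' b'"
  by (auto simp: open_strip_def strip_def)

text \<open>\<open>2560 = 160 * 2 * 8\<close>: the area \<open>160 * (w * L i)\<close> of a dilated
  strip, the loss from absorbing half of the sum, and the factor in the hypothesis on averages. The
  root comes from the choice of \<open>e\<close> in Young's inequality.\<close>

definition weak_const :: "nat \<Rightarrow> real" where
  "weak_const m = 2560 * (16 * overlap_const m) powr (1 / real m)"

lemma weak_const_pos: "weak_const m > 0"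
  using overlap_const_pos[of m] by (simp add: weak_const_def)

text \<open>Duality: for the selected strips with overlap \<open>N\<close>, the sum \<open>S\<close>
  of the \<open>w * L i\<close> is at most eight times the integral of \<open>N * g\<close>. Young's
  inequality splits this into the moment of \<open>N\<close>, which the overlap lemma bounds by a
  multiple of \<open>S / d ^ m\<close> and which is absorbed, and the power of
  \<open>g\<close>.\<close>

lemma weak_type_strips:
  fixes c a s L :: "'i \<Rightarrow> real" and E :: "'i \<Rightarrow> real set" and g :: "real \<times> real \<Rightarrow> real"
  assumes d: "d > 0" and w: "w > 0" and m: "m \<ge> 1"
    and L: "\<And>i. i \<in> I \<Longrightarrow> L i > 0"
    and Em: "\<And>i. i \<in> I \<Longrightarrow> E i \<in> sets lebesgue"
    and EJ: "\<And>i. i \<in> I \<Longrightarrow> E i \<subseteq> {c i - L i..c i + L i}"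
    and Eu: "\<And>i. i \<in> I \<Longrightarrow> u ` E i \<subseteq> {s i - w / L i..s i + w / L i}"
    and dens: "\<And>i. i \<in> I \<Longrightarrow> emeasure lebesgue (E i) \<ge> ennreal (d * L i)"
    and g: "g \<in> borel_measurable lebesgue" "\<And>z. g z \<ge> 0"
    and avg: "\<And>i. i \<in> I \<Longrightarrow> ennreal (w * L i) \<le>
        8 * (\<integral>\<^sup>+z. ennreal (g z) * indicator (strip (c i) (a i) (s i) (L i) w) z \<partial>lebesgue)"
  shows "emeasure lborel (\<Union>i\<in>I. open_strip (c i) (a i) (s i) (2 * L i) (2 * w))
    \<le> ennreal (weak_const m / d) * (\<integral>\<^sup>+z. ennreal (g z powr (1 + 1 / real m)) \<partial>lebesgue)"
proof (rule emeasure_Union_open_le)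
  let ?O = "\<lambda>i. open_strip (c i) (a i) (s i) (2 * L i) (2 * w)"
  show "open S" if "S \<in> ?O ` I" for S using that open_open_strip by blast
  fix F' assume "F' \<subseteq> ?O ` I" "finite F'"
  then obtain A where A: "A \<subseteq> I" "finite A" "F' = ?O ` A"
    by (meson finite_subset_image)
  define P where "P = (\<lambda>i. strip (c i) (a i) (s i) (L i) w)"
  define W where "W = (\<lambda>i. {s i - w / L i..s i + w / L i})"
  have ne: "P i \<noteq> {} \<and> W i \<noteq> {}" if "i \<in> A" for i
  proof -
    have "L i > 0" using that A L by blast
    then have "(c i, a i) \<in> P i" "s i \<in> W i" using w by (auto simp: P_def W_def strip_def)
    then show ?thesis by blast
  qed
  obtain G where G: "G \<subseteq> A"
    and sep: "\<And>x y. x \<in> G \<Longrightarrow> y \<in> G \<Longrightarrow> x \<noteq> y \<Longrightarrow> \<not> (P x \<inter> P y \<noteq> {} \<and> W x \<inter> W y \<noteq> {})"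
    and cov: "\<And>x. x \<in> A \<Longrightarrow> \<exists>y\<in>G. (P x \<inter> P y \<noteq> {} \<and> W x \<inter> W y \<noteq> {}) \<and> L x \<le> L y"
  proof (rule greedy_selection[OF A(2), of "\<lambda>x y. P x \<inter> P y \<noteq> {} \<and> W x \<inter> W y \<noteq> {}" L])
  qed (use ne in \<open>simp_all add: Int_commute\<close>)
  have GI: "G \<subseteq> I" and finG: "finite G" using G A finite_subset[OF G A(2)] by simp_all
  define S where "S = (\<Sum>i\<in>G. w * L i)"
  have S0: "S \<ge> 0" unfolding S_def using GI L w by (intro sum_nonneg) (auto intro!: mult_nonneg_nonneg simp: less_imp_le)
  define N where "N = (\<lambda>z. card {i \<in> G. z \<in> P i})"
  define K where "K = overlap_const m"
  define X where "X = (\<integral>\<^sup>+z. ennreal (g z powr (1 + 1 / real m)) \<partial>lebesgue)"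
  have K: "K > 0" by (simp add: K_def overlap_const_pos)
  have Nsum: "ennreal (real (N z)) = (\<Sum>i\<in>G. indicator (P i) z)" for z
  proof -
    have "(\<Sum>i\<in>G. indicator (P i) z :: ennreal) = (\<Sum>i\<in>{i \<in> G. z \<in> P i}. 1)"
      using finG by (intro sum.mono_neutral_cong_right) (auto simp: indicator_def)
    then show ?thesis by (simp add: N_def ennreal_of_nat_eq_real_of_nat)
  qed
  have Pm: "P i \<in> sets lebesgue" for i by (simp add: P_def sets_strip)
  have gm: "(\<lambda>z. ennreal (g z)) \<in> borel_measurable lebesgue"
    using g(1) by measurable
  have Nm: "(\<lambda>z. ennreal (real (N z))) \<in> borel_measurable lebesgue"
    unfolding Nsum by (intro borel_measurable_sum borel_measurable_indicator Pm)
  have Nm': "(\<lambda>z. ennreal (real (N z) ^ k)) \<in> borel_measurable lebesgue" for k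
    unfolding ennreal_power[OF of_nat_0_le_iff, symmetric] by (intro borel_measurable_power_ennreal Nm)
  have ov: "(\<integral>\<^sup>+z. ennreal (real (N z) ^ Suc m) \<partial>lebesgue) \<le> ennreal (K / d ^ m * S)"
  proof -
    have "(\<integral>\<^sup>+z. of_nat (N z ^ Suc m) \<partial>lborel) \<le> ennreal (K / d ^ m * S)"
      unfolding N_def P_def K_def S_def
    proof (rule overlap_power_integral[OF finG d w, where E = E and u = u])
      fix i j assume ij: "i \<in> G" "j \<in> G" "i \<noteq> j"
        and "strip (c i) (a i) (s i) (L i) w \<inter> strip (c j) (a j) (s j) (L j) w \<noteq> {}"
      then show "{s i - w / L i..s i + w / L i} \<inter> {s j - w / L j..s j + w / L j} = {}"
        using sep[OF ij] unfolding P_def W_def by blast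
    next
      fix i assume "i \<in> G"
      then have i: "i \<in> I" using GI by blast
      show "0 < L i" "E i \<in> sets lebesgue" "E i \<subseteq> {c i - L i..c i + L i}"
        "u ` E i \<subseteq> {s i - w / L i..s i + w / L i}" "ennreal (d * L i) \<le> emeasure lebesgue (E i)"
        by (fact L[OF i] Em[OF i] EJ[OF i] Eu[OF i] dens[OF i])+
    qed
    then show ?thesis
      by (simp add: nn_integral_completion ennreal_of_nat_eq_real_of_nat del: power_Suc of_nat_power)
        (simp only: of_nat_power)
  qed
  \<comment> \<open>Chosen so that \<open>8 * e * K / d ^ m = 1 / 2\<close>. Then
    \<open>e powr (- 1 / real m)\<close> is exactly linear in \<open>1 / d\<close>.\<close>
  define e where "e = d ^ m / (16 * K)"
  have e: "e > 0" using d K by (simp add: e_def)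
  define q where "q = (16 * K) powr (1 / real m) / d"
  have epow: "e powr (- 1 / real m) = q"
  proof -
    have "(d ^ m) powr (1 / real m) = d"
      using d m by (simp add: powr_realpow[symmetric] powr_powr)
    moreover have "e powr (- 1 / real m) = inverse (e powr (1 / real m))"
      by (simp add: powr_minus[symmetric])
    ultimately show ?thesis using d K by (simp add: e_def q_def powr_divide)
  qed
  have "ennreal S = (\<Sum>i\<in>G. ennreal (w * L i))"
    unfolding S_def using GI L w by (intro sum_ennreal[symmetric]) (auto intro!: mult_nonneg_nonneg simp: less_imp_le)
  also have "\<dots> \<le> (\<Sum>i\<in>G. 8 * (\<integral>\<^sup>+z. ennreal (g z) * indicator (P i) z \<partial>lebesgue))"
    unfolding P_def using GI avg by (intro sum_mono) blast
  also have "\<dots> = 8 * (\<integral>\<^sup>+z. (\<Sum>i\<in>G. ennreal (g z) * indicator (P i) z) \<partial>lebesgue)"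
  proof -
    have "(\<integral>\<^sup>+z. (\<Sum>i\<in>G. ennreal (g z) * indicator (P i) z) \<partial>lebesgue) =
        (\<Sum>i\<in>G. \<integral>\<^sup>+z. ennreal (g z) * indicator (P i) z \<partial>lebesgue)"
      by (intro nn_integral_sum borel_measurable_times_ennreal gm borel_measurable_indicator Pm)
    then show ?thesis by (simp only: sum_distrib_left)
  qed
  also have "\<dots> = 8 * (\<integral>\<^sup>+z. ennreal (real (N z) * g z) \<partial>lebesgue)"
    using g(2) by (simp only: sum_distrib_left[symmetric] Nsum[symmetric] ennreal_mult of_nat_0_le_iff mult.commute)
  also have "\<dots> \<le> 8 * (\<integral>\<^sup>+z. ennreal e * ennreal (real (N z) ^ Suc m) +
        ennreal (e powr (- 1 / real m)) * ennreal (g z powr (1 + 1 / real m)) \<partial>lebesgue)"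
  proof (intro mult_left_mono nn_integral_mono)
    fix z
    show "ennreal (real (N z) * g z) \<le> ennreal e * ennreal (real (N z) ^ Suc m) +
        ennreal (e powr (- 1 / real m)) * ennreal (g z powr (1 + 1 / real m))"
      using ennreal_leI[OF mult_le_powers[of "real (N z)" "g z" e m]] e m g(2)[of z]
      by (simp add: ennreal_plus ennreal_mult del: power_Suc)
  qed simp
  also have "\<dots> = 8 * (ennreal e * (\<integral>\<^sup>+z. ennreal (real (N z) ^ Suc m) \<partial>lebesgue) + ennreal (e powr (- 1 / real m)) * X)"
  proof -
    have "(\<lambda>z. ennreal (g z powr (1 + 1 / real m))) \<in> borel_measurable lebesgue" using g(1) by measurable
    then show ?thesis unfolding X_def
      by (subst nn_integral_add) (intro borel_measurable_times_ennreal Nm' borel_measurable_const, simp_all add: nn_integral_cmult Nm' del: power_Suc)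
  qed
  also have "\<dots> \<le> 8 * (ennreal e * ennreal (K / d ^ m * S) + ennreal (e powr (- 1 / real m)) * X)"
    by (intro mult_left_mono add_mono ov) auto
  also have "\<dots> = ennreal (S / 2) + ennreal (8 * q) * X"
  proof -
    have "8 * (ennreal e * ennreal (K / d ^ m * S)) = ennreal (8 * (e * (K / d ^ m * S)))"
      using e by (simp only: ennreal_mult' ennreal_numeral zero_le_numeral less_imp_le)
    moreover have "8 * (e * (K / d ^ m * S)) = S / 2" using d K by (simp add: e_def)
    moreover have "8 * (ennreal (e powr (- 1 / real m)) * X) = ennreal (8 * q) * X"
      unfolding epow by (simp only: ennreal_mult' ennreal_numeral zero_le_numeral mult.assoc)
    ultimately show ?thesis by (simp only: distrib_left)
  qed
  finally have half: "ennreal S \<le> ennreal (S / 2) + ennreal (8 * q) * X" .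
  \<comment> \<open>\<open>S\<close> is a finite sum of reals, so \<open>S / 2\<close> may be
    subtracted; when the right-hand side is infinite there is nothing to show.\<close>
  have S: "ennreal S \<le> 2 * (ennreal (8 * q) * X)"
  proof (cases "ennreal (8 * q) * X")
    case (real y)
    then have "ennreal S \<le> ennreal (S / 2 + y)" using half S0 by (simp add: ennreal_plus)
    then have "S \<le> S / 2 + y" using S0 real by (subst (asm) ennreal_le_iff) simp_all
    then have "S \<le> 2 * y" by linarith
    then have "ennreal S \<le> ennreal (2 * y)" by (rule ennreal_leI)
    then show ?thesis using real by (simp only: ennreal_mult' ennreal_numeral zero_le_numeral)
  qed (simp add: ennreal_mult_eq_top_iff)
  \<comment> \<open>Every doubled strip of \<open>A\<close> lies in a dilate of a selected one, of
    area \<open>4 * (4 * L i) * (10 * w)\<close>.\<close>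
  have "emeasure lborel (\<Union>F') \<le> emeasure lborel (\<Union>i\<in>G. strip (c i) (a i) (s i) (4 * L i) (10 * w))"
  proof (rule emeasure_mono)
    show "\<Union>F' \<subseteq> (\<Union>i\<in>G. strip (c i) (a i) (s i) (4 * L i) (10 * w))"
    proof
      fix z assume "z \<in> \<Union>F'"
      then obtain i where i: "i \<in> A" "z \<in> ?O i" using A(3) by blast
      obtain j where j: "j \<in> G" "P i \<inter> P j \<noteq> {}" "W i \<inter> W j \<noteq> {}" "L i \<le> L j"
        using cov[OF i(1)] by blast
      have Li: "L i > 0" using L i A by blast
      have sub: "strip (c i) (a i) (s i) (2 * L i) (2 * w) \<subseteq> strip (c j) (a j) (s j) (4 * L j) (10 * w)"
        using j(2,3) unfolding P_def W_def by (rule strip_dilate_subset[OF _ _ Li j(4) w])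
      have "z \<in> strip (c i) (a i) (s i) (2 * L i) (2 * w)" using i(2) by (rule subsetD[OF open_strip_subset])
      then have "z \<in> strip (c j) (a j) (s j) (4 * L j) (10 * w)" by (rule subsetD[OF sub])
      with j(1) show "z \<in> (\<Union>i\<in>G. strip (c i) (a i) (s i) (4 * L i) (10 * w))" by (rule UN_I)
    qed
    show "(\<Union>i\<in>G. strip (c i) (a i) (s i) (4 * L i) (10 * w)) \<in> sets lborel"
      using finG by (intro sets.finite_UN) (simp_all add: sets_strip)
  qed
  also have "\<dots> \<le> (\<Sum>i\<in>G. emeasure lborel (strip (c i) (a i) (s i) (4 * L i) (10 * w)))"
    using finG by (intro emeasure_subadditive_finite) (auto simp: sets_strip)
  also have "\<dots> = (\<Sum>i\<in>G. ennreal (160 * (w * L i)))"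
  proof (intro sum.cong refl)
    fix i assume "i \<in> G"
    then have "L i > 0" using GI L by blast
    then show "emeasure lborel (strip (c i) (a i) (s i) (4 * L i) (10 * w)) = ennreal (160 * (w * L i))"
      using w by (subst emeasure_strip) (simp_all add: mult_ac)
  qed
  also have "\<dots> = ennreal (160 * S)"
    unfolding S_def sum_distrib_left using GI L w
    by (intro sum_ennreal) (auto intro!: mult_nonneg_nonneg simp: less_imp_le)
  also have "\<dots> = 160 * ennreal S" using S0 by (simp add: ennreal_mult)
  also have "\<dots> \<le> 160 * (2 * (ennreal (8 * q) * X))"
    by (intro mult_left_mono S) simp
  also have "\<dots> = ennreal (160 * 2 * (8 * q)) * X"
    by (simp only: ennreal_mult' ennreal_numeral zero_le_numeral mult.assoc)
  also have "160 * 2 * (8 * q) = weak_const m / d"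
    by (simp add: weak_const_def K_def q_def)
  finally show "emeasure lborel (\<Union>F') \<le> ennreal (weak_const m / d) * (\<integral>\<^sup>+z. ennreal (g z powr (1 + 1 / real m)) \<partial>lebesgue)"
    by (simp add: X_def)
qed

text \<open>
  The maximal function is an uncountable supremum. Open supersets of its level sets avoid the
  question of its measurability.
\<close>

lemma maxop_weak_type:
  fixes f :: "real \<times> real \<Rightarrow> real"
  defines "g \<equiv> \<lambda>t z. if \<bar>f z\<bar> > t then \<bar>f z\<bar> / t else 0"
  assumes u: "u \<in> borel_measurable (lebesgue_on {0..1})" "\<And>x. x \<in> {0..1} \<Longrightarrow> u x \<in> {0..1}"
    and \<delta>: "0 < \<delta>" and w: "0 < w" and f: "f \<in> borel_measurable lebesgue" and t: "0 < t" and m: "m \<ge> 1"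
  obtains U where "open U" and "{z. ennreal (2 * t) < maxop (Rfam u \<delta> w) f z} \<subseteq> U"
    and "emeasure lborel U \<le> ennreal (16 * weak_const m / \<delta>) *
      (\<integral>\<^sup>+z. ennreal (g t z powr (1 + 1 / real m)) \<partial>lebesgue)"
proof -
  have gm [measurable]: "g t \<in> borel_measurable lebesgue"
    unfolding g_def using f by measurable
  have g0: "g t z \<ge> 0" for z using t by (simp add: g_def)
  \<comment> \<open>An index is a triple \<open>(c, th, L)\<close>. The last condition says that
    \<open>g t\<close> has average at least one on the rectangle.\<close>
  define I where "I = {i. cos (fst (snd i)) \<noteq> 0 \<and> w \<le> snd (snd i) \<and>
      measure lebesgue (Vset u (fst i) (fst (snd i)) (snd (snd i)) w) \<ge> \<delta> * measure lebesgue (rect (fst i) (fst (snd i)) (snd (snd i)) w) \<and>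
      ennreal (measure lebesgue (rect (fst i) (fst (snd i)) (snd (snd i)) w)) \<le>
        (\<integral>\<^sup>+z. ennreal (g t z) * indicator (rect (fst i) (fst (snd i)) (snd (snd i)) w) z \<partial>lebesgue)}"
  define E where "E = (\<lambda>i::(real \<times> real) \<times> real \<times> real.
      {x \<in> {0..1} \<inter> {fst (fst i) - snd (snd i)..fst (fst i) + snd (snd i)}. u x \<in> EX_int (fst (snd i)) (snd (snd i)) w})"
  define U where "U = (\<Union>i\<in>I. open_strip (fst (fst i)) (snd (fst i)) (tan (fst (snd i))) (2 * snd (snd i)) (2 * w))"
  have dense: "1 / 2 \<le> \<bar>cos (fst (snd i))\<bar> \<and> E i \<in> sets lebesgue \<and> ennreal (\<delta> / 16 * snd (snd i)) \<le> emeasure lebesgue (E i)"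
    if "cos (fst (snd i)) \<noteq> 0" "w \<le> snd (snd i)"
      "measure lebesgue (Vset u (fst i) (fst (snd i)) (snd (snd i)) w) \<ge> \<delta> * measure lebesgue (rect (fst i) (fst (snd i)) (snd (snd i)) w)"
    for i
    unfolding E_def using rect_dense_slopes[OF u \<delta> w that(2,1,3)] by blast
  \<comment> \<open>The density \<open>\<delta> / 16\<close> of the sets \<open>E i\<close> is the
    source of the factor 16 in the conclusion.\<close>
  have "emeasure lborel U \<le> ennreal (weak_const m / (\<delta> / 16)) * (\<integral>\<^sup>+z. ennreal (g t z powr (1 + 1 / real m)) \<partial>lebesgue)"
    unfolding U_def
  proof (rule weak_type_strips[where E = E and u = u])
    fix i assume "i \<in> I"
    then have i: "cos (fst (snd i)) \<noteq> 0" "w \<le> snd (snd i)"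
      "measure lebesgue (Vset u (fst i) (fst (snd i)) (snd (snd i)) w) \<ge> \<delta> * measure lebesgue (rect (fst i) (fst (snd i)) (snd (snd i)) w)"
      "ennreal (measure lebesgue (rect (fst i) (fst (snd i)) (snd (snd i)) w)) \<le>
        (\<integral>\<^sup>+z. ennreal (g t z) * indicator (rect (fst i) (fst (snd i)) (snd (snd i)) w) z \<partial>lebesgue)"
      unfolding I_def mem_Collect_eq by - (elim conjE, assumption)+
    note D = dense[OF i(1-3)]
    show L: "0 < snd (snd i)" using i(2) w by linarith
    show "E i \<in> sets lebesgue" "ennreal (\<delta> / 16 * snd (snd i)) \<le> emeasure lebesgue (E i)" using D by - (elim conjE, assumption)+
    show "E i \<subseteq> {fst (fst i) - snd (snd i)..fst (fst i) + snd (snd i)}" unfolding E_def by blast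
    \<comment> \<open>\<open>EX_int\<close> has half-width \<open>w / (2 * L)\<close>; the strips
      work with windows twice as wide.\<close>
    have "w / (2 * snd (snd i)) \<le> w / snd (snd i)" using L w by (simp add: field_simps)
    then show "u ` E i \<subseteq> {tan (fst (snd i)) - w / snd (snd i)..tan (fst (snd i)) + w / snd (snd i)}"
      unfolding E_def EX_int_def by fastforce
    let ?R = "rect (fst i) (fst (snd i)) (snd (snd i)) w"
    let ?S = "strip (fst (fst i)) (snd (fst i)) (tan (fst (snd i))) (snd (snd i)) w"
    have RS: "?R \<subseteq> ?S" using D w i(2) by (intro rect_subset_strip) simp_all
    \<comment> \<open>The factor 8 compares \<open>w * L\<close> with the lower bound for the area,
      whose cosine is at least \<open>1 / 2\<close>.\<close>
    have "w * snd (snd i) = 8 * (1 / 2 * snd (snd i) * w / 4)" by simp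
    also have "\<dots> \<le> 8 * (\<bar>cos (fst (snd i))\<bar> * snd (snd i) * w / 4)"
      using D L w by (intro mult_left_mono divide_right_mono mult_right_mono) simp_all
    also have "\<dots> \<le> 8 * measure lebesgue ?R"
      using i(1,2) w by (intro mult_left_mono measure_rect_ge) simp_all
    finally have "ennreal (w * snd (snd i)) \<le> ennreal (8 * measure lebesgue ?R)" by (rule ennreal_leI)
    also have "\<dots> = 8 * ennreal (measure lebesgue ?R)"
      by (simp only: ennreal_mult' ennreal_numeral zero_le_numeral)
    also have "\<dots> \<le> 8 * (\<integral>\<^sup>+z. ennreal (g t z) * indicator ?R z \<partial>lebesgue)" by (intro mult_left_mono i(4)) simp
    also have "\<dots> \<le> 8 * (\<integral>\<^sup>+z. ennreal (g t z) * indicator ?S z \<partial>lebesgue)"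
      using RS by (intro mult_left_mono nn_integral_mono) (auto simp: indicator_def)
    finally show "ennreal (w * snd (snd i)) \<le> 8 * (\<integral>\<^sup>+z. ennreal (g t z) * indicator ?S z \<partial>lebesgue)" .
  qed (use \<delta> w m gm g0 in simp_all)
  moreover have "open U" unfolding U_def by (intro open_UN ballI open_open_strip)
  moreover have "{z. ennreal (2 * t) < maxop (Rfam u \<delta> w) f z} \<subseteq> U"
  proof
    fix z assume "z \<in> {z. ennreal (2 * t) < maxop (Rfam u \<delta> w) f z}"
    then obtain R where R: "R \<in> Rfam u \<delta> w" "z \<in> R"
      and big: "ennreal (2 * t) < ennreal (1 / measure lebesgue R) * (\<integral>\<^sup>+x\<in>R. ennreal \<bar>f x\<bar> \<partial>lebesgue)"
      unfolding maxop_def by (auto simp: less_SUP_iff)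
    from R(1) obtain c th L where Rdef: "R = rect c th L w" and c: "cos th \<noteq> 0" "w \<le> L"
        "measure lebesgue (Vset u c th L w) \<ge> \<delta> * measure lebesgue (rect c th L w)"
      unfolding Rfam_def by blast
    define M where "M = measure lebesgue R"
    have Rlm: "R \<in> lmeasurable" unfolding Rdef by (intro lmeasurable_compact compact_rect)
    have Rs: "R \<in> sets lebesgue" using Rlm by (rule fmeasurableD)
    have "0 < \<bar>cos th\<bar> * L * w / 4" using c w by simp
    also have "\<dots> \<le> M" unfolding M_def Rdef using c w by (intro measure_rect_ge) simp_all
    finally have M: "0 < M" .
    define X where "X = (\<integral>\<^sup>+z. ennreal (g t z) * indicator R z \<partial>lebesgue)"
    \<comment> \<open>Marcinkiewicz truncation: values up to \<open>t\<close> add at most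
      \<open>t\<close> to an average, so an average above \<open>2 * t\<close> forces
      \<open>g t\<close> to have average at least one.\<close>
    have "(\<integral>\<^sup>+x\<in>R. ennreal \<bar>f x\<bar> \<partial>lebesgue) \<le> (\<integral>\<^sup>+x. ennreal t * (ennreal (g t x) * indicator R x) + ennreal t * indicator R x \<partial>lebesgue)"
    proof (intro nn_integral_mono)
      fix x
      have "\<bar>f x\<bar> \<le> t * g t x + t" using t by (simp add: g_def)
      then have "ennreal \<bar>f x\<bar> \<le> ennreal (t * g t x + t)" by (rule ennreal_leI)
      also have "\<dots> = ennreal t * ennreal (g t x) + ennreal t"
        using t g0[of x] by (simp add: ennreal_plus ennreal_mult)
      finally show "ennreal \<bar>f x\<bar> * indicator R x \<le> ennreal t * (ennreal (g t x) * indicator R x) + ennreal t * indicator R x"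
        by (cases "x \<in> R") simp_all
    qed
    also have "\<dots> = ennreal t * X + ennreal t * ennreal M"
    proof -
      have m1: "(\<lambda>x. ennreal (g t x) * indicator R x) \<in> borel_measurable lebesgue"
        using gm Rs by measurable
      have m2: "(indicator R :: _ \<Rightarrow> ennreal) \<in> borel_measurable lebesgue" using Rs by (rule borel_measurable_indicator)
      have "(\<integral>\<^sup>+x. indicator R x \<partial>lebesgue) = ennreal M"
        unfolding M_def using Rs emeasure_eq_measure2[OF Rlm] by (simp only: nn_integral_indicator)
      then show ?thesis
        unfolding X_def by (simp only: nn_integral_add nn_integral_cmult m1 m2 borel_measurable_times_ennreal borel_measurable_const)
    qed
    finally have lt: "ennreal (2 * t) < ennreal (1 / M) * (ennreal t * X + ennreal t * ennreal M)"
      using big unfolding M_def[symmetric] by (meson less_le_trans mult_left_mono zero_le)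
    have "ennreal M \<le> X"
    proof (rule ccontr)
      assume "\<not> ennreal M \<le> X"
      then have "ennreal t * X + ennreal t * ennreal M \<le> ennreal t * ennreal M + ennreal t * ennreal M"
        by (intro add_mono mult_left_mono) simp_all
      then have "ennreal (1 / M) * (ennreal t * X + ennreal t * ennreal M) \<le> ennreal (1 / M) * (ennreal t * ennreal M + ennreal t * ennreal M)"
        by (rule mult_left_mono) simp
      also have "\<dots> = ennreal (1 / M * (t * M + t * M))"
      proof -
        have tM: "0 \<le> t * M" "0 \<le> t" "0 \<le> 1 / M" using M t by simp_all
        show ?thesis by (simp only: ennreal_mult'[OF tM(2)] ennreal_plus[OF tM(1,1)] ennreal_mult'[OF tM(3)])
      qed
      also have "1 / M * (t * M + t * M) = 2 * t" using M by simp
      finally show False using lt by (rule leD[THEN notE])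
    qed
    then have "(c, th, L) \<in> I" using c unfolding I_def M_def X_def Rdef by simp
    moreover have "z \<in> open_strip (fst c) (snd c) (tan th) (2 * L) (2 * w)"
    proof -
      have "1 / 2 \<le> \<bar>cos th\<bar>" using dense[of "(c, th, L)"] c by simp
      then have "z \<in> strip (fst c) (snd c) (tan th) L w"
        using R(2) w c(2) unfolding Rdef by (intro subsetD[OF rect_subset_strip]) simp_all
      then show ?thesis using w c(2) by (intro subsetD[OF strip_subset_open_strip]) simp_all
    qed
    ultimately show "z \<in> U" unfolding U_def by force
  qed
  ultimately show ?thesis using that[of U] by (simp add: mult.commute)
qed

subsection \<open>Interpolation\<close>

text \<open>Dyadic levels are indexed by all integers and \<open>suminf\<close> by naturals, so
  \<open>int_decode\<close> enumerates them. Counting down from the top level \<open>K\<close>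
  leaves an ordinary geometric series.\<close>

lemma suminf_int_geometric:
  fixes q :: real
  assumes "0 \<le> q" "q < 1"
  shows "(\<Sum>n. if int_decode n \<le> K then ennreal (q ^ nat (K - int_decode n)) else 0) = ennreal (1 / (1 - q))"
proof -
  let ?b = "\<lambda>k. if k \<le> K then ennreal (q ^ nat (K - k)) else 0"
  have bij: "bij_betw (\<lambda>j. K - int j) UNIV {..K}"
    by (rule bij_betw_byWitness[where f' = "\<lambda>k. nat (K - k)"]) auto
  have "(\<Sum>n. ?b (int_decode n)) = (\<integral>\<^sup>+n. ?b (int_decode n) \<partial>count_space UNIV)"
    by (rule nn_integral_count_space_nat[symmetric])
  also have "\<dots> = (\<integral>\<^sup>+k. ?b k \<partial>count_space UNIV)"
    by (rule nn_integral_bij_count_space[OF bij_int_decode])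
  also have "\<dots> = (\<integral>\<^sup>+k. ennreal (q ^ nat (K - k)) * indicator {..K} k \<partial>count_space UNIV)"
    by (intro nn_integral_cong) simp
  also have "\<dots> = (\<integral>\<^sup>+k. ennreal (q ^ nat (K - k)) \<partial>count_space {..K})"
    by (simp add: nn_integral_count_space_indicator)
  also have "\<dots> = (\<integral>\<^sup>+j. ennreal (q ^ nat (K - (K - int j))) \<partial>count_space UNIV)"
    by (rule nn_integral_bij_count_space[OF bij, symmetric])
  also have "\<dots> = (\<Sum>j. ennreal (q ^ j))"
    by (simp add: nn_integral_count_space_nat)
  also have "\<dots> = ennreal (1 / (1 - q))"
    using assms by (intro suminf_ennreal_eq geometric_sums) simp_all
  finally show ?thesis .
qed

text \<open>A dyadic layer-cake bound. For finite positive \<open>v\<close> the single term with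
  \<open>2 * 2 powr k < v\<close> and \<open>v \<le> 4 * 2 powr k\<close> suffices; for infinite
  \<open>v\<close> all terms are present and they are unbounded.\<close>

lemma powr_le_level_sum:
  fixes v :: ennreal and U :: "int \<Rightarrow> 'a set"
  assumes p: "1 < p" and U: "\<And>k. ennreal (2 * 2 powr real_of_int k) < v \<Longrightarrow> z \<in> U k"
  shows "epowr v p \<le> (\<Sum>n. ennreal ((4 * 2 powr real_of_int (int_decode n)) powr p) * indicator (U (int_decode n)) z)"
proof -
  let ?h = "\<lambda>k. ennreal ((4 * 2 powr real_of_int k) powr p) * indicator (U k) z :: ennreal"
  have single: "?h k \<le> (\<Sum>n. ?h (int_decode n))" for k
  proof -
    have "(\<Sum>n\<in>{int_encode k}. ?h (int_decode n)) \<le> (\<Sum>n. ?h (int_decode n))"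
      by (rule sum_le_suminf) simp_all
    then show ?thesis by simp
  qed
  show ?thesis
  proof (cases v)
    case top
    have "of_nat j \<le> (\<Sum>n. ?h (int_decode n))" for j :: nat
    proof -
      have "z \<in> U (int j)" using top by (intro U) simp
      moreover have "real j \<le> (4 * 2 powr real j) powr p"
      proof -
        have "real j \<le> 2 powr real j" using of_nat_less_two_power[of j] by (simp add: powr_realpow less_imp_le)
        also have "\<dots> \<le> (4 * 2 powr real j) powr 1" by simp
        also have "\<dots> \<le> (4 * 2 powr real j) powr p"
        proof (rule powr_mono)
          have "1 \<le> 2 powr real j" by (rule ge_one_powr_ge_zero) simp_all
          then show "1 \<le> 4 * 2 powr real j" by linarith
        qed (use p in simp)
        finally show ?thesis .
      qed
      ultimately have "of_nat j \<le> ?h (int j)" by (simp add: ennreal_of_nat_eq_real_of_nat ennreal_leI)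
      then show ?thesis using single[of "int j"] by (rule order_trans)
    qed
    then have "(\<Sum>n. ?h (int_decode n)) = \<infinity>"
      by (metis ennreal_Ex_less_of_nat infinity_ennreal_def not_le top.not_eq_extremum)
    then show ?thesis by (simp only: infinity_ennreal_def top_greatest)
  next
    case (real x)
    show ?thesis
    proof (cases "x = 0")
      case True
      then show ?thesis using real by (simp add: epowr_def)
    next
      case False
      then have x: "0 < x" using real by simp
      \<comment> \<open>The ceiling makes the lower inequality strict, as the hypothesis on
        \<open>U k\<close> requires.\<close>
      define k where "k = \<lceil>log 2 x\<rceil> - 2"
      have k: "real_of_int k + 1 < log 2 x" "log 2 x \<le> real_of_int k + 2"
        unfolding k_def by linarith+
      have "2 * 2 powr real_of_int k = 2 powr (real_of_int k + 1)" by (simp add: powr_add)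
      also have "\<dots> < x" using k(1) x by (simp add: less_log_iff)
      finally have "z \<in> U k" using real by (intro U) (simp add: ennreal_less_iff)
      have "x \<le> 2 powr (real_of_int k + 2)" using k(2) x by (simp add: log_le_iff)
      also have "\<dots> = 4 * 2 powr real_of_int k" by (simp add: powr_add)
      finally have "x powr p \<le> (4 * 2 powr real_of_int k) powr p" using x p by (intro powr_mono2) simp_all
      then have "epowr v p \<le> ?h k" using real \<open>z \<in> U k\<close> by (simp add: epowr_def ennreal_leI)
      then show ?thesis using single[of k] by (rule order_trans)
    qed
  qed
qed

text \<open>Only levels below \<open>F\<close> contribute, each by a multiple of
  \<open>F powr r * 2 powr (k * (p - r))\<close>. As \<open>r < p\<close>, this is geometric with
  ratio \<open>2 powr (r - p)\<close> downwards from the top level, where it is at most a multiple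
  of \<open>F powr p\<close>.\<close>

lemma level_sum_le_powr:
  fixes F p r :: real
  assumes F: "0 \<le> F" and r: "1 < r" "r < p"
  shows "(\<Sum>n. ennreal ((4 * 2 powr real_of_int (int_decode n)) powr p) *
      ennreal ((if F > 2 powr real_of_int (int_decode n) then F / 2 powr real_of_int (int_decode n) else 0) powr r))
    \<le> ennreal (4 powr p / (1 - 2 powr (r - p)) * F powr p)"
proof (cases "F = 0")
  case True
  then have "\<not> F > 2 powr real_of_int k" for k by (simp add: not_less)
  then show ?thesis by simp
next
  case False
  then have F: "0 < F" using assms by simp
  \<comment> \<open>The largest integer \<open>k\<close> with \<open>2 powr k < F\<close>.\<close>
  define K where "K = \<lceil>log 2 F\<rceil> - 1"
  define q where "q = 2 powr (r - p)"
  have q: "0 \<le> q" "q < 1" using r powr_less_mono[of "r - p" 0 2] by (simp_all add: q_def)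
  have iff: "2 powr real_of_int k < F \<longleftrightarrow> k \<le> K" for k
  proof -
    have "2 powr real_of_int k < F \<longleftrightarrow> real_of_int k < log 2 F" using F by (simp add: less_log_iff)
    also have "\<dots> \<longleftrightarrow> k \<le> K" unfolding K_def by linarith
    finally show ?thesis .
  qed
  have term_le: "ennreal ((4 * 2 powr real_of_int k) powr p) *
      ennreal ((if F > 2 powr real_of_int k then F / 2 powr real_of_int k else 0) powr r)
    \<le> ennreal (4 powr p * F powr p) * (if k \<le> K then ennreal (q ^ nat (K - k)) else 0)" for k
  proof (cases "k \<le> K")
    case True
    have qpow: "q ^ nat (K - k) = 2 powr ((r - p) * real_of_int (K - k))"
      using True by (simp add: q_def powr_powr flip: powr_realpow)
    have "(4 * 2 powr real_of_int k) powr p * (F / 2 powr real_of_int k) powr r =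
        4 powr p * (2 powr (real_of_int k * p) * (F powr r / 2 powr (real_of_int k * r)))"
      using F by (simp add: powr_mult powr_divide powr_powr)
    also have "2 powr (real_of_int k * p) * (F powr r / 2 powr (real_of_int k * r)) =
        F powr r * 2 powr (real_of_int k * p - real_of_int k * r)"
      by (simp add: powr_diff)
    also have "real_of_int k * p - real_of_int k * r = real_of_int K * (p - r) + (r - p) * real_of_int (K - k)"
      by (simp add: algebra_simps)
    also have "2 powr \<dots> = (2 powr real_of_int K) powr (p - r) * q ^ nat (K - k)"
      by (simp add: powr_add powr_powr qpow)
    also have "4 powr p * (F powr r * ((2 powr real_of_int K) powr (p - r) * q ^ nat (K - k)))
        \<le> 4 powr p * (F powr r * (F powr (p - r) * q ^ nat (K - k)))"
      using iff[of K] r q by (intro mult_left_mono mult_right_mono powr_mono2) simp_all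
    also have "\<dots> = 4 powr p * F powr p * q ^ nat (K - k)"
      using F by (simp add: powr_diff)
    finally have "(4 * 2 powr real_of_int k) powr p * (F / 2 powr real_of_int k) powr r
        \<le> 4 powr p * F powr p * q ^ nat (K - k)" .
    then show ?thesis using True iff[of k] q by (simp add: ennreal_leI flip: ennreal_mult)
  next
    case False
    then show ?thesis using iff[of k] by simp
  qed
  have "(\<Sum>n. ennreal ((4 * 2 powr real_of_int (int_decode n)) powr p) *
      ennreal ((if F > 2 powr real_of_int (int_decode n) then F / 2 powr real_of_int (int_decode n) else 0) powr r))
    \<le> (\<Sum>n. ennreal (4 powr p * F powr p) * (if int_decode n \<le> K then ennreal (q ^ nat (K - int_decode n)) else 0))"
    by (intro suminf_le term_le) simp_all
  also have "\<dots> = ennreal (4 powr p * F powr p) * ennreal (1 / (1 - q))"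
    by (simp only: ennreal_suminf_cmult suminf_int_geometric[OF q])
  also have "\<dots> = ennreal (4 powr p / (1 - q) * F powr p)"
    using q by (simp flip: ennreal_mult)
  finally show ?thesis by (simp only: q_def)
qed

lemma epowr_mono: "a \<le> b \<Longrightarrow> 0 \<le> q \<Longrightarrow> epowr a q \<le> epowr b q"
  unfolding epowr_def
  by (cases a; cases b) (auto intro!: ennreal_leI powr_mono2 simp: top_unique)

lemma epowr_cmult:
  assumes "0 < c" "0 < q"
  shows "epowr (ennreal c * a) q = ennreal (c powr q) * epowr a q"
proof (cases a)
  case (real x)
  then show ?thesis using assms by (simp add: epowr_def powr_mult flip: ennreal_mult)
next
  case top
  then show ?thesis using assms by (simp add: epowr_def ennreal_mult_top)
qed

theorem theorem2:
  shows "\<exists>w0 > 0. \<forall>p. 1 < p \<longrightarrow> (\<exists>C > 0. \<forall>u \<delta> w f.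
      u \<in> borel_measurable (lebesgue_on {0..1}) \<and> (\<forall>x \<in> {0..1}. u x \<in> {0..1}) \<and>
      0 < \<delta> \<and> \<delta> \<le> 1 \<and> 0 < w \<and> w < w0 \<and>
      f \<in> borel_measurable lebesgue \<and> Lp_norm p (\<lambda>z. ennreal \<bar>f z\<bar>) < \<infinity>
      \<longrightarrow> Lp_norm p (maxop (Rfam u \<delta> w) f)
            \<le> ennreal (C / \<delta>) * Lp_norm p (\<lambda>z. ennreal \<bar>f z\<bar>))"
proof (rule exI[of _ 1], intro conjI allI impI)
  fix p :: real assume p: "1 < p"
  \<comment> \<open>A large \<open>m\<close> brings the exponent \<open>1 + 1 / m\<close> of the
    weak type estimate below \<open>p\<close>, as interpolation requires.\<close>
  obtain m where m: "m \<ge> 1" "1 + 1 / real m < p"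
  proof -
    obtain n where "inverse (real (Suc n)) < p - 1" using reals_Archimedean[of "p - 1"] p by auto
    then show ?thesis using that[of "Suc n"] by (simp add: inverse_eq_divide)
  qed
  define r where "r = 1 + 1 / real m"
  have r: "1 < r" "r < p" using m by (simp_all add: r_def)
  define A D where "A = 16 * weak_const m" and "D = 4 powr p / (1 - 2 powr (r - p))"
  have A: "0 < A" using weak_const_pos by (simp add: A_def)
  have D: "0 < D" using r powr_less_mono[of "r - p" 0 2] by (simp add: D_def)
  show "\<exists>C > 0. \<forall>u \<delta> w f.
      u \<in> borel_measurable (lebesgue_on {0..1}) \<and> (\<forall>x \<in> {0..1}. u x \<in> {0..1}) \<and>
      0 < \<delta> \<and> \<delta> \<le> 1 \<and> 0 < w \<and> w < 1 \<and>
      f \<in> borel_measurable lebesgue \<and> Lp_norm p (\<lambda>z. ennreal \<bar>f z\<bar>) < \<infinity>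
      \<longrightarrow> Lp_norm p (maxop (Rfam u \<delta> w) f) \<le> ennreal (C / \<delta>) * Lp_norm p (\<lambda>z. ennreal \<bar>f z\<bar>)"
  proof (rule exI[of _ "(A * D) powr (1 / p)"], intro conjI allI impI)
    show "0 < (A * D) powr (1 / p)" using A D by simp
    fix u :: "real \<Rightarrow> real" and \<delta> w :: real and f :: "real \<times> real \<Rightarrow> real"
    assume "u \<in> borel_measurable (lebesgue_on {0..1}) \<and> (\<forall>x \<in> {0..1}. u x \<in> {0..1}) \<and>
      0 < \<delta> \<and> \<delta> \<le> 1 \<and> 0 < w \<and> w < 1 \<and>
      f \<in> borel_measurable lebesgue \<and> Lp_norm p (\<lambda>z. ennreal \<bar>f z\<bar>) < \<infinity>"
    then have u: "u \<in> borel_measurable (lebesgue_on {0..1})" "\<forall>x \<in> {0..1}. u x \<in> {0..1}"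
      and \<delta>: "0 < \<delta>" "\<delta> \<le> 1" and w: "0 < w" and f: "f \<in> borel_measurable lebesgue"
      by - (elim conjE, assumption)+
    define g where "g = (\<lambda>t z. if \<bar>f z\<bar> > t then \<bar>f z\<bar> / t else 0)"
    have gm: "(\<lambda>z. ennreal (g t z powr r)) \<in> borel_measurable lebesgue" for t
      unfolding g_def using f by measurable
    let ?M = "maxop (Rfam u \<delta> w) f"
    have "\<exists>U. open U \<and> {z. ennreal (2 * 2 powr real_of_int k) < ?M z} \<subseteq> U \<and>
        emeasure lborel U \<le> ennreal (A / \<delta>) * (\<integral>\<^sup>+z. ennreal (g (2 powr real_of_int k) z powr r) \<partial>lebesgue)" for k
    proof -
      have pos: "0 < 2 powr real_of_int k" by simp
      obtain U where "open U" "{z. ennreal (2 * 2 powr real_of_int k) < ?M z} \<subseteq> U"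
        "emeasure lborel U \<le> ennreal (A / \<delta>) * (\<integral>\<^sup>+z. ennreal (g (2 powr real_of_int k) z powr r) \<partial>lebesgue)"
        unfolding A_def r_def g_def
        by (rule maxop_weak_type[OF u(1) bspec[OF u(2)] \<delta>(1) w f pos m(1)])
      then show ?thesis by (intro exI[of _ U] conjI)
    qed
    then obtain U where U: "\<And>k. open (U k)" "\<And>k. {z. ennreal (2 * 2 powr real_of_int k) < ?M z} \<subseteq> U k"
      "\<And>k. emeasure lborel (U k) \<le> ennreal (A / \<delta>) * (\<integral>\<^sup>+z. ennreal (g (2 powr real_of_int k) z powr r) \<partial>lebesgue)"
      by metis
    define a where "a = (\<lambda>n. ennreal ((4 * 2 powr real_of_int (int_decode n)) powr p))"
    define V where "V = (\<lambda>n. U (int_decode n))"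
    define G where "G = (\<lambda>n z. ennreal (g (2 powr real_of_int (int_decode n)) z powr r))"
    have Vs: "V n \<in> sets lborel" for n unfolding V_def using U(1) by simp
    have Gm: "G n \<in> borel_measurable lebesgue" for n unfolding G_def by (rule gm)
    \<comment> \<open>\<open>nn_integral\<close> is a supremum over simple functions below the
      integrand, so this identity and the monotonicity that follows apply to \<open>maxop\<close> as
      it is; the majorant built from open sets is measurable.\<close>
    have "(\<integral>\<^sup>+z. epowr (?M z) p \<partial>lebesgue) = (\<integral>\<^sup>+z. epowr (?M z) p \<partial>lborel)"
      by (rule nn_integral_completion)
    also have "\<dots> \<le> (\<integral>\<^sup>+z. (\<Sum>n. a n * indicator (V n) z) \<partial>lborel)"
      unfolding a_def V_def using U(2) by (intro nn_integral_mono powr_le_level_sum[OF p]) blast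
    also have "\<dots> = (\<Sum>n. \<integral>\<^sup>+z. a n * indicator (V n) z \<partial>lborel)"
      by (intro nn_integral_suminf borel_measurable_times_ennreal borel_measurable_const borel_measurable_indicator Vs)
    also have "\<dots> = (\<Sum>n. a n * emeasure lborel (V n))"
      by (simp only: nn_integral_cmult_indicator[OF Vs])
    also have "\<dots> \<le> (\<Sum>n. ennreal (A / \<delta>) * (\<integral>\<^sup>+z. a n * G n z \<partial>lebesgue))"
    proof (intro suminf_le)
      fix n
      have "a n * emeasure lborel (V n) \<le> a n * (ennreal (A / \<delta>) * (\<integral>\<^sup>+z. G n z \<partial>lebesgue))"
        unfolding V_def G_def by (intro mult_left_mono U(3)) simp
      also have "\<dots> = ennreal (A / \<delta>) * (\<integral>\<^sup>+z. a n * G n z \<partial>lebesgue)"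
        by (simp only: nn_integral_cmult[OF Gm] mult.left_commute)
      finally show "a n * emeasure lborel (V n) \<le> \<dots>" .
    qed simp_all
    also have "\<dots> = ennreal (A / \<delta>) * (\<integral>\<^sup>+z. (\<Sum>n. a n * G n z) \<partial>lebesgue)"
      by (simp only: ennreal_suminf_cmult nn_integral_suminf borel_measurable_times_ennreal borel_measurable_const Gm)
    also have "\<dots> \<le> ennreal (A / \<delta>) * (\<integral>\<^sup>+z. ennreal (D * \<bar>f z\<bar> powr p) \<partial>lebesgue)"
      unfolding a_def G_def g_def D_def
      by (intro mult_left_mono nn_integral_mono level_sum_le_powr r) simp_all
    also have "\<dots> = ennreal (A / \<delta>) * (ennreal D * (\<integral>\<^sup>+z. epowr (ennreal \<bar>f z\<bar>) p \<partial>lebesgue))"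
    proof -
      have "(\<lambda>z. ennreal (\<bar>f z\<bar> powr p)) \<in> borel_measurable lebesgue" using f by measurable
      then show ?thesis using D by (simp add: epowr_def ennreal_mult' nn_integral_cmult)
    qed
    also have "\<dots> = ennreal (A * D / \<delta>) * (\<integral>\<^sup>+z. epowr (ennreal \<bar>f z\<bar>) p \<partial>lebesgue)"
      using A D \<delta> by (simp add: mult.assoc[symmetric] flip: ennreal_mult)
    finally have "Lp_norm p ?M \<le> epowr (ennreal (A * D / \<delta>) * (\<integral>\<^sup>+z. epowr (ennreal \<bar>f z\<bar>) p \<partial>lebesgue)) (1 / p)"
      unfolding Lp_norm_def using p by (intro epowr_mono) simp_all
    also have "\<dots> = ennreal ((A * D / \<delta>) powr (1 / p)) * Lp_norm p (\<lambda>z. ennreal \<bar>f z\<bar>)"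
      unfolding Lp_norm_def using A D \<delta> p by (intro epowr_cmult) simp_all
    \<comment> \<open>The root turns \<open>1 / \<delta>\<close> into
      \<open>\<delta> powr (- 1 / p)\<close>, which is at most \<open>1 / \<delta>\<close> because
      \<open>\<delta> \<le> 1\<close> and \<open>p > 1\<close>.\<close>
    also have "\<dots> \<le> ennreal ((A * D) powr (1 / p) / \<delta>) * Lp_norm p (\<lambda>z. ennreal \<bar>f z\<bar>)"
    proof (intro mult_right_mono ennreal_leI)
      have "\<delta> powr 1 \<le> \<delta> powr (1 / p)" using \<delta> p by (intro powr_mono') simp_all
      then have "\<delta> \<le> \<delta> powr (1 / p)" using \<delta> by simp
      then have "(A * D) powr (1 / p) / \<delta> powr (1 / p) \<le> (A * D) powr (1 / p) / \<delta>"
        using \<delta> by (intro divide_left_mono) simp_all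
      then show "(A * D / \<delta>) powr (1 / p) \<le> (A * D) powr (1 / p) / \<delta>"
        using A D \<delta> by (simp add: powr_divide)
    qed simp
    finally show "Lp_norm p ?M \<le> ennreal ((A * D) powr (1 / p) / \<delta>) * Lp_norm p (\<lambda>z. ennreal \<bar>f z\<bar>)" .
  qed
qed simp

end
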